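(* One has $$\lambda_2^L=\inf_{\gamma\in\Gamma}\ \max_{u\in\gamma[-1,1]}\mathcal{E}_L(u,u),$$ where $\Gamma$ is the family of all continuous paths in $\mathcal{P}$ going from $-\varphi_1$ to $\varphi_1$.
   Context: Let $N\ge 1$ be an integer and let $\Omega\subset\mathbb{R}^N$ be a bounded domain (open and connected) with $C^{1,1}$ boundary. $\|\cdot\|_2$ is the $L^2(\Omega)$ norm. Put $c_N=\pi^{-N/2}\Gamma(N/2)$ and $\rho_N=2\ln 2+\psi(N/2)-\gamma$, with $\psi=\Gamma'/\Gamma$ the digamma function and $\gamma=-\Gamma'(1)$; $B_1$ is the unit ball centred at $0$, $k(z)=\mathbf 1_{B_1}(z)|z|^{-N}$, $j(z)=\mathbf 1_{\mathbb{R}^N\setminus B_1}(z)|z|^{-N}$ for $z\neq 0$. $\mathbb{H}(\Omega)$ is the Hilbert space of all $u\in L^2(\Omega)$, extended by $u=0$ in $\mathbb{R}^N\setminus\Omega$, with $\iint_{\mathbb{R}^{2N}}|u(x)-u(y)|^2k(x-y)\,dx\,dy<\infty$, with inner product $\mathcal{E}(u,v)=\frac{c_N}{2}\iint_{\mathbb{R}^{2N}}(u(x)-u(y))(v(x)-v(y))k(x-y)\,dx\,dy$ and norm $\|u\|=\mathcal{E}(u,u)^{1/2}$. The quadratic form of the logarithmic Laplacian $L_\Delta$ (the operator with Fourier symbol $2\ln|\xi|$) is $$\mathcal{E}_L(u,v)=\mathcal{E}(u,v)-c_N\iint_{\mathbb{R}^{2N}}u(x)v(y)j(x-y)\,dx\,dy+\rho_N\int_{\mathbb{R}^N}uv\,dx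 .$$ An eigenvalue of $L_\Delta$ is a $\lambda\in\mathbb{R}$ for which there is a nontrivial $u\in\mathbb{H}(\Omega)$ with $\mathcal{E}_L(u,v)=\lambda\int_\Omega uv\,dx$ for all $v\in\mathbb{H}(\Omega)$. The eigenvalues form an unbounded sequence $\lambda_1^L<\lambda_2^L\le\cdots\le\lambda_k^L\le\cdots\to+\infty$; $\lambda_2^L$ is the second eigenvalue. The first one, $\lambda_1^L=\min\{\mathcal{E}_L(u,u):u\in\mathbb{H}(\Omega),\|u\|_2=1\}$, is simple, and $\varphi_1>0$ denotes the associated eigenfunction with $\|\varphi_1\|_2=1$. Finally $\mathcal{P}=\{u\in\mathbb{H}(\Omega):\int_\Omega u^2\,dx=1\}$ with the topology of $\mathbb{H}(\Omega)$, so $\Gamma=\{\gamma\in C([-1,1],\mathcal{P}):\gamma(-1)=-\varphi_1,\gamma(1)=\varphi_1\}$. *)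

theory Defs
  imports "HOL-Analysis.Analysis"
begin

definition log_lap_c :: "nat \<Rightarrow> real" where
  "log_lap_c N = pi powr (- (real N / 2)) * Gamma (real N / 2)"

text \<open>The library constant \<open>euler_mascheroni\<close> is minus the derivative of \<open>Gamma\<close> at 1.\<close>

definition log_lap_rho :: "nat \<Rightarrow> real" where
  "log_lap_rho N = 2 * ln 2 + Digamma (real N / 2) - euler_mascheroni"

definition kernel_k :: "real ^ 'n \<Rightarrow> real" where
  "kernel_k z = indicator (ball 0 1) z / norm z ^ CARD('n)"

definition kernel_j :: "real ^ 'n \<Rightarrow> real" where
  "kernel_j z = indicator (- ball 0 1) z / norm z ^ CARD('n)"

text \<open>
  A \<open>C^{1,1}\<close> boundary: near each boundary point, \<open>\<Omega>\<close> is the strict epigraph, in some unit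
  direction \<open>e\<close>, of a \<open>C^{1,1}\<close> function of the component orthogonal to \<open>e\<close>.  The function
  \<open>g\<close> is taken on the whole space, but only its values on the hyperplane orthogonal to \<open>e\<close>
  matter; a \<open>C^{1,1}\<close> function on that hyperplane extends by composing with the projection.
  In dimension one the hyperplane is a point and the condition concerns interval endpoints.
\<close>

definition C11_function :: "('a::euclidean_space \<Rightarrow> real) \<Rightarrow> bool" where
  "C11_function g \<longleftrightarrow>
     (\<exists>G L. (\<forall>x. (g has_derivative (\<lambda>h. G x \<bullet> h)) (at x)) \<and> L-lipschitz_on UNIV G)"

definition C11_boundary :: "('a::euclidean_space) set \<Rightarrow> bool" where
  "C11_boundary \<Omega> \<longleftrightarrow>
     (\<forall>p\<in>frontier \<Omega>. \<exists>r>0. \<exists>e g. norm e = 1 \<and> C11_function g \<and>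
        \<Omega> \<inter> ball p r = {x \<in> ball p r. g (x - (x \<bullet> e) *\<^sub>R e) < x \<bullet> e})"

text \<open>
  Elements of \<open>H(\<Omega>)\<close> are represented by Borel functions on the whole space that vanish
  outside \<open>\<Omega>\<close>; two of them stand for the same element iff they agree almost everywhere.
\<close>

definition H_space :: "(real ^ 'n) set \<Rightarrow> (real ^ 'n \<Rightarrow> real) set" where
  "H_space \<Omega> = {u. u \<in> borel_measurable borel \<and> (\<forall>x. x \<notin> \<Omega> \<longrightarrow> u x = 0) \<and>
     integrable lborel (\<lambda>x. (u x)\<^sup>2) \<and>
     integrable (lborel \<Otimes>\<^sub>M lborel) (\<lambda>(x, y). (u x - u y)\<^sup>2 * kernel_k (x - y))}"

definition energy :: "(real ^ 'n \<Rightarrow> real) \<Rightarrow> (real ^ 'n \<Rightarrow> real) \<Rightarrow> real" where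
  "energy u v = log_lap_c CARD('n) / 2 *
     (\<integral>(x, y). (u x - u y) * (v x - v y) * kernel_k (x - y) \<partial>(lborel \<Otimes>\<^sub>M lborel))"

definition H_norm :: "(real ^ 'n \<Rightarrow> real) \<Rightarrow> real" where
  "H_norm u = sqrt (energy u u)"

definition energy_L :: "(real ^ 'n \<Rightarrow> real) \<Rightarrow> (real ^ 'n \<Rightarrow> real) \<Rightarrow> real" where
  "energy_L u v = energy u v
     - log_lap_c CARD('n) * (\<integral>(x, y). u x * v y * kernel_j (x - y) \<partial>(lborel \<Otimes>\<^sub>M lborel))
     + log_lap_rho CARD('n) * (\<integral>x. u x * v x \<partial>lborel)"

definition eigenfunction :: "(real ^ 'n) set \<Rightarrow> real \<Rightarrow> (real ^ 'n \<Rightarrow> real) \<Rightarrow> bool" where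
  "eigenfunction \<Omega> lam u \<longleftrightarrow> u \<in> H_space \<Omega> \<and> \<not> (AE x in lborel. u x = 0) \<and>
     (\<forall>v\<in>H_space \<Omega>. energy_L u v = lam * (LINT x:\<Omega>|lborel. u x * v x))"

definition eigenvalue :: "(real ^ 'n) set \<Rightarrow> real \<Rightarrow> bool" where
  "eigenvalue \<Omega> lam \<longleftrightarrow> (\<exists>u. eigenfunction \<Omega> lam u)"

text \<open>
  The \<open>k\<close>-th term, \<open>k \<ge> 1\<close>, of the nondecreasing sequence of eigenvalues repeated according
  to multiplicity: the least eigenvalue \<open>lam\<close> such that there are \<open>k\<close> eigenfunctions with
  eigenvalues at most \<open>lam\<close> that are linearly independent modulo null sets.
\<close>

definition nth_eigenvalue :: "(real ^ 'n) set \<Rightarrow> nat \<Rightarrow> real" where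
  "nth_eigenvalue \<Omega> k = (LEAST lam. eigenvalue \<Omega> lam \<and>
     (\<exists>e. (\<forall>i<k. \<exists>\<mu>\<le>lam. eigenfunction \<Omega> \<mu> (e i)) \<and>
          (\<forall>c. (AE x in lborel. (\<Sum>i<k. c i * e i x) = 0) \<longrightarrow> (\<forall>i<k. c i = 0))))"

definition P_sphere :: "(real ^ 'n) set \<Rightarrow> (real ^ 'n \<Rightarrow> real) set" where
  "P_sphere \<Omega> = {u \<in> H_space \<Omega>. (LINT x:\<Omega>|lborel. (u x)\<^sup>2) = 1}"

text \<open>
  The endpoint conditions are equalities of elements of \<open>H(\<Omega>)\<close>, hence hold almost everywhere.
  Values of \<open>\<gamma>\<close> outside \<open>[-1,1]\<close> are irrelevant.
\<close>

definition P_paths ::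
  "(real ^ 'n) set \<Rightarrow> (real ^ 'n \<Rightarrow> real) \<Rightarrow> (real \<Rightarrow> real ^ 'n \<Rightarrow> real) set" where
  "P_paths \<Omega> \<phi> = {\<gamma>. (\<forall>t\<in>{-1..1}. \<gamma> t \<in> P_sphere \<Omega>) \<and>
     (\<forall>t\<in>{-1..1}. ((\<lambda>s. H_norm (\<lambda>x. \<gamma> s x - \<gamma> t x)) \<longlongrightarrow> 0) (at t within {-1..1})) \<and>
     (AE x in lborel. \<gamma> (-1) x = - \<phi> x) \<and> (AE x in lborel. \<gamma> 1 x = \<phi> x)}"

end

theory Submission
  imports Defs
begin

text \<open>
  Let \<open>E\<^sub>L\<close> be the quadratic form and \<open>\<phi>\<^sub>1\<close> the first eigenfunction.  The second eigenvalue is the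
  minimum of \<open>E\<^sub>L\<close> over the part of the unit sphere orthogonal to \<open>\<phi>\<^sub>1\<close>
  (\<open>second_eigenvalue_variational\<close>).  Given this, both inequalities are short.  The pairing with
  \<open>\<phi>\<^sub>1\<close> varies continuously from \<open>-1\<close> to \<open>1\<close> along a path, so the path meets the hyperplane
  orthogonal to \<open>\<phi>\<^sub>1\<close> (\<open>path_crosses_hyperplane\<close>), where \<open>E\<^sub>L\<close> is at least the second eigenvalue.
  Conversely, let \<open>u\<close> be a normalized second eigenfunction orthogonal to \<open>\<phi>\<^sub>1\<close>.  On the half circle
  \<open>sin s \<phi>\<^sub>1 + cos s u\<close> (\<open>half_circle_path\<close>) the form \<open>E\<^sub>L\<close> is a weighted mean of the first two
  eigenvalues, so it never exceeds the second one.

  Two facts about \<open>H(\<Omega>)\<close> carry the argument.  The Poincare inequality makes continuity in the energy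
  norm imply continuity in mean square, hence continuity of \<open>E\<^sub>L\<close> and of the pairing with \<open>\<phi>\<^sub>1\<close>; it
  holds because a walk with steps shorter than 1 leaves the bounded set \<open>\<Omega>\<close> after boundedly many
  steps.  The compactness of bounded sets of \<open>H(\<Omega>)\<close> in mean square (\<open>compact_embedding\<close>) provides the
  minimizers, since the energy is lower semicontinuous and the rest of \<open>E\<^sub>L\<close> is bounded in mean
  square (\<open>low_form_bound\<close>).

  Compactness rests on the divergence of \<open>\<integral> k\<close> at the origin, which is only logarithmic.  On each
  cube of a grid, the mean square of \<open>w\<close> is the square of its mean plus the mean of
  \<open>(w(x) - w(y))\<^sup>2 / 2\<close> over pairs of points.  On a single dyadic level, the oscillation terms of all
  cubes are bounded by the energy, with no small factor.  But the first \<open>m\<close> levels together are also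
  bounded by one multiple of the energy, because the weights \<open>|Q|\<^sup>-\<^sup>1\<close> of the cubes \<open>Q\<close> containing both
  \<open>x\<close> and \<open>y\<close> form a geometric sum bounded by a multiple of
  \<open>k(x - y)\<close>.  Averaging over the levels gains a factor
  \<open>1/m\<close> (\<open>l2_le_cube_averages\<close>), and what remains are finitely many cube integrals.

  The minimization takes place in a nontrivial set because \<open>H(\<Omega>)\<close> contains two bumps with disjoint
  supports (\<open>exists_orthogonal\<close>).
\<close>

section \<open>Symmetric bilinear forms on spaces of functions\<close>

locale symmetric_form =
  fixes V :: "('a \<Rightarrow> real) set" and B :: "('a \<Rightarrow> real) \<Rightarrow> ('a \<Rightarrow> real) \<Rightarrow> real"
  assumes lin_closed: "u \<in> V \<Longrightarrow> v \<in> V \<Longrightarrow> (\<lambda>x. a * u x + b * v x) \<in> V"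
    and sym: "u \<in> V \<Longrightarrow> v \<in> V \<Longrightarrow> B u v = B v u"
    and lin: "u \<in> V \<Longrightarrow> v \<in> V \<Longrightarrow> w \<in> V \<Longrightarrow>
      B (\<lambda>x. a * u x + b * v x) w = a * B u w + b * B v w"
begin

lemma lin_right:
  assumes "u \<in> V" "v \<in> V" "w \<in> V"
  shows "B w (\<lambda>x. a * u x + b * v x) = a * B w u + b * B w v"
  using lin[OF assms, of a b] sym[OF assms(3)] assms lin_closed by metis

lemma expand:
  assumes "u \<in> V" "v \<in> V"
  shows "B (\<lambda>x. a * u x + b * v x) (\<lambda>x. a * u x + b * v x)
     = a\<^sup>2 * B u u + 2 * a * b * B u v + b\<^sup>2 * B v v"
proof -
  have "B v u = B u v" using sym assms by blast
  then show ?thesis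
    using assms lin_closed by (simp add: lin lin_right power2_eq_square algebra_simps)
qed

lemma diff_closed: "u \<in> V \<Longrightarrow> v \<in> V \<Longrightarrow> (\<lambda>x. u x - v x) \<in> V"
  using lin_closed[of u v 1 "-1"] by simp

lemma scale_closed: "u \<in> V \<Longrightarrow> (\<lambda>x. a * u x) \<in> V"
  using lin_closed[of u u a 0] by simp

lemma diff_left:
  "u \<in> V \<Longrightarrow> v \<in> V \<Longrightarrow> w \<in> V \<Longrightarrow> B (\<lambda>x. u x - v x) w = B u w - B v w"
  using lin[of u v w 1 "-1"] by simp

lemma scale: "u \<in> V \<Longrightarrow> B (\<lambda>x. a * u x) (\<lambda>x. a * u x) = a\<^sup>2 * B u u"
  using expand[of u u a 0] by simp

lemma expand_diff:
  "u \<in> V \<Longrightarrow> v \<in> V \<Longrightarrow>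
    B (\<lambda>x. u x - v x) (\<lambda>x. u x - v x) = B u u - 2 * B u v + B v v"
  using expand[of u v 1 "-1"] by simp

text \<open>
  Along the line through \<open>u\<close> in the direction \<open>v\<close> the form is a parabola with its minimum at
  \<open>u\<close>, so its slope there vanishes.
\<close>

lemma isotropic_minimum_orthogonal:
  assumes "u \<in> V" "v \<in> V" and pos: "\<And>a. B (\<lambda>x. u x + a * v x) (\<lambda>x. u x + a * v x) \<ge> 0"
    and "B u u = 0"
  shows "B u v = 0"
proof -
  have ge: "2 * a * B u v + a\<^sup>2 * B v v \<ge> 0" for a
  proof -
    have "B (\<lambda>x. u x + a * v x) (\<lambda>x. u x + a * v x) = 2 * a * B u v + a\<^sup>2 * B v v"
      using expand[of u v 1 a] assms by simp
    then show ?thesis using pos[of a] by linarith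
  qed
  have "B v v \<ge> 0" using ge[of 1] ge[of "-1"] by simp
  define d where "d = B v v + 1"
  define a where "a = - B u v / d"
  have ad: "a * d = - B u v" using \<open>B v v \<ge> 0\<close> by (simp add: a_def d_def)
  have "0 \<le> d\<^sup>2 * (2 * a * B u v + a\<^sup>2 * B v v)" using ge[of a] by simp
  also have "\<dots> = 2 * d * B u v * (a * d) + (a * d)\<^sup>2 * B v v"
    by (simp add: power2_eq_square algebra_simps)
  also have "\<dots> = - ((B u v)\<^sup>2 * (B v v + 2))"
    unfolding ad by (simp add: d_def power2_eq_square algebra_simps)
  finally have "(B u v)\<^sup>2 * (B v v + 2) \<le> 0" by simp
  then have "(B u v)\<^sup>2 \<le> 0" using \<open>B v v \<ge> 0\<close> by (simp add: mult_le_0_iff)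
  then show ?thesis by simp
qed

end

locale nonneg_form = symmetric_form +
  assumes nonneg: "u \<in> V \<Longrightarrow> B u u \<ge> 0"
begin

text \<open>
  For \<open>B(v,v) > 0\<close> this is the nonnegativity of \<open>B\<close> at the multiple \<open>B(v,v) u - B(u,v) v\<close> of the
  component of \<open>u\<close> orthogonal to \<open>v\<close>; a \<open>v\<close> with \<open>B(v,v) = 0\<close> minimizes the form, hence is
  orthogonal to everything.
\<close>

lemma Cauchy_Schwarz:
  assumes "u \<in> V" "v \<in> V"
  shows "(B u v)\<^sup>2 \<le> B u u * B v v"
proof (cases "B v v = 0")
  case True
  have "B v u = 0"
    using isotropic_minimum_orthogonal[of v u] assms True nonneg lin_closed[of v u 1] by simp
  then show ?thesis using True sym assms by simp
next
  case False
  then have pos: "B v v > 0" using nonneg[of v] assms by linarith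
  define a where "a = B v v"
  define b where "b = - B u v"
  have "0 \<le> a\<^sup>2 * B u u + 2 * a * b * B u v + b\<^sup>2 * B v v"
    using nonneg[OF lin_closed[OF assms, of a b]] expand[OF assms, of a b] by simp
  also have "\<dots> = B v v * (B u u * B v v - (B u v)\<^sup>2)"
    by (simp add: a_def b_def power2_eq_square algebra_simps)
  finally show ?thesis using pos by (simp add: zero_le_mult_iff)
qed

text \<open>
  By the Cauchy-Schwarz inequality, convergence in the seminorm implies weak convergence.
\<close>

lemma tendsto_pairing:
  assumes ev: "\<forall>\<^sub>F s in F. f s \<in> V" and "v \<in> V" "w \<in> V"
    and lim: "((\<lambda>s. B (\<lambda>x. f s x - v x) (\<lambda>x. f s x - v x)) \<longlongrightarrow> 0) F"
  shows "((\<lambda>s. B (f s) w) \<longlongrightarrow> B v w) F"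
proof -
  have "((\<lambda>s. sqrt (B (\<lambda>x. f s x - v x) (\<lambda>x. f s x - v x) * B w w)) \<longlongrightarrow> sqrt (0 * B w w)) F"
    by (intro tendsto_intros lim)
  then have "((\<lambda>s. sqrt (B (\<lambda>x. f s x - v x) (\<lambda>x. f s x - v x) * B w w)) \<longlongrightarrow> 0) F"
    by simp
  moreover have "\<forall>\<^sub>F s in F. norm (B (f s) w - B v w)
      \<le> sqrt (B (\<lambda>x. f s x - v x) (\<lambda>x. f s x - v x) * B w w)"
    using ev
  proof eventually_elim
    case (elim s)
    have "\<bar>B (\<lambda>x. f s x - v x) w\<bar> \<le> sqrt (B (\<lambda>x. f s x - v x) (\<lambda>x. f s x - v x) * B w w)"
      using Cauchy_Schwarz[of "\<lambda>x. f s x - v x" w] elim assms diff_closed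
      by (intro real_le_rsqrt) auto
    then show ?case using elim assms by (simp add: diff_left)
  qed
  ultimately have "((\<lambda>s. B (f s) w - B v w) \<longlongrightarrow> 0) F"
    by (rule Lim_null_comparison[rotated])
  then show ?thesis by (simp add: LIM_zero_iff)
qed

lemma tendsto_square:
  assumes ev: "\<forall>\<^sub>F s in F. f s \<in> V" and "v \<in> V"
    and lim: "((\<lambda>s. B (\<lambda>x. f s x - v x) (\<lambda>x. f s x - v x)) \<longlongrightarrow> 0) F"
  shows "((\<lambda>s. B (f s) (f s)) \<longlongrightarrow> B v v) F"
proof -
  have "((\<lambda>s. B (\<lambda>x. f s x - v x) (\<lambda>x. f s x - v x) + 2 * B (f s) v - B v v)
      \<longlongrightarrow> 0 + 2 * B v v - B v v) F"
    by (intro tendsto_intros lim tendsto_pairing[OF ev] assms)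
  moreover have "\<forall>\<^sub>F s in F.
      B (\<lambda>x. f s x - v x) (\<lambda>x. f s x - v x) + 2 * B (f s) v - B v v = B (f s) (f s)"
    using ev by eventually_elim (use assms in \<open>simp add: expand_diff\<close>)
  ultimately show ?thesis by (simp cong: filterlim_cong add: tendsto_cong)
qed

end

lemma symmetric_form_combine:
  assumes "symmetric_form V B" "symmetric_form V C"
  shows "symmetric_form V (\<lambda>u v. a * B u v + b * C u v)"
proof -
  interpret B: symmetric_form V B by fact
  interpret C: symmetric_form V C by fact
  show ?thesis
    by unfold_locales (auto simp: B.lin C.lin B.lin_closed B.sym C.sym algebra_simps)
qed

section \<open>The bilinear forms on the energy space\<close>

lemma integrable_mult_of_squares:
  fixes f g :: "'a \<Rightarrow> real"
  assumes [measurable]: "f \<in> borel_measurable M" "g \<in> borel_measurable M"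
    and "integrable M (\<lambda>x. (f x)\<^sup>2)" "integrable M (\<lambda>x. (g x)\<^sup>2)"
  shows "integrable M (\<lambda>x. f x * g x)"
proof (rule Bochner_Integration.integrable_bound)
  show "integrable M (\<lambda>x. (f x)\<^sup>2 + (g x)\<^sup>2)" using assms by simp
  have "\<bar>a * b\<bar> \<le> a\<^sup>2 + b\<^sup>2" for a b :: real
  proof -
    have "0 \<le> \<bar>a * b\<bar>" "2 * \<bar>a * b\<bar> \<le> a\<^sup>2 + b\<^sup>2"
      using sum_squares_bound[of "\<bar>a\<bar>" "\<bar>b\<bar>"] by (simp_all add: abs_mult mult.assoc)
    then show ?thesis by linarith
  qed
  then show "AE x in M. norm (f x * g x) \<le> norm ((f x)\<^sup>2 + (g x)\<^sup>2)" by simp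
qed measurable

lemma (in pair_sigma_finite) integrable_product_mult:
  fixes f :: "'a \<Rightarrow> real" and g :: "'b \<Rightarrow> real"
  assumes "integrable M1 f" "integrable M2 g"
  shows "integrable (M1 \<Otimes>\<^sub>M M2) (\<lambda>(x, y). f x * g y)"
proof -
  have [measurable]: "f \<in> borel_measurable M1" "g \<in> borel_measurable M2" using assms by auto
  show ?thesis
  proof (rule Fubini_integrable)
    have "(\<lambda>x. LINT y|M2. norm (f x * g y)) = (\<lambda>x. \<bar>f x\<bar> * (LINT y|M2. \<bar>g y\<bar>))"
      by (simp add: abs_mult)
    then show "integrable M1 (\<lambda>x. LINT y|M2. norm (case (x, y) of (x, y) \<Rightarrow> f x * g y))"
      using assms by simp
  qed (use assms in auto)
qed

lemma kernel_k_measurable [measurable]: "kernel_k \<in> borel_measurable borel"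
  unfolding kernel_k_def[abs_def]
  by (intro borel_measurable_divide borel_measurable_indicator borel_measurable_power) auto

lemma kernel_j_measurable [measurable]: "kernel_j \<in> borel_measurable borel"
  unfolding kernel_j_def[abs_def]
  by (intro borel_measurable_divide borel_measurable_indicator borel_measurable_power) auto

lemma kernel_k_nonneg: "kernel_k z \<ge> 0"
  by (simp add: kernel_k_def)

lemma kernel_k_minus: "kernel_k (- z) = kernel_k z"
  by (simp add: kernel_k_def indicator_def)

lemma kernel_j_minus: "kernel_j (- z) = kernel_j z"
  by (simp add: kernel_j_def indicator_def)

lemma kernel_j_nonneg: "kernel_j z \<ge> 0"
  by (simp add: kernel_j_def)

lemma kernel_j_le_1: "kernel_j z \<le> 1"
  by (auto simp: kernel_j_def indicator_def divide_le_eq dest!: one_le_power)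

lemma log_lap_c_pos: "log_lap_c CARD('n::finite) > 0"
  unfolding log_lap_c_def by (intro mult_pos_pos Gamma_real_pos) auto

definition l2 :: "(real ^ 'n \<Rightarrow> real) \<Rightarrow> (real ^ 'n \<Rightarrow> real) \<Rightarrow> real" where
  "l2 u v = (\<integral>x. u x * v x \<partial>lborel)"

definition far_form :: "(real ^ 'n \<Rightarrow> real) \<Rightarrow> (real ^ 'n \<Rightarrow> real) \<Rightarrow> real" where
  "far_form u v = (\<integral>(x, y). u x * v y * kernel_j (x - y) \<partial>(lborel \<Otimes>\<^sub>M lborel))"

text \<open>
  The part of \<open>E\<^sub>L\<close> besides the energy.  It is bounded in mean square, so it does not affect the
  compactness and semicontinuity properties of the energy.
\<close>

definition low_form :: "(real ^ 'n \<Rightarrow> real) \<Rightarrow> (real ^ 'n \<Rightarrow> real) \<Rightarrow> real" where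
  "low_form u v = - log_lap_c CARD('n) * far_form u v + log_lap_rho CARD('n) * l2 u v"

lemma energy_L_decompose: "energy_L u v = energy u v + low_form u v"
  by (simp add: energy_L_def far_form_def l2_def low_form_def)

locale bounded_domain =
  fixes \<Omega> :: "(real ^ 'n) set"
  assumes open_domain: "open \<Omega>" and bounded_domain: "bounded \<Omega>"
begin

abbreviation "H \<equiv> H_space \<Omega>"

lemma domain_borel [measurable]: "\<Omega> \<in> sets borel"
  using open_domain by simp

lemma emeasure_domain: "emeasure lborel \<Omega> < \<infinity>"
  using bounded_domain emeasure_bounded_finite by blast

lemma integrable_indicator_domain: "integrable lborel (indicator \<Omega> :: _ \<Rightarrow> real)"
  using emeasure_domain by (intro integrable_real_indicator) auto

lemma
  assumes "u \<in> H"
  shows H_measurable: "u \<in> borel_measurable borel"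
    and H_zero: "x \<notin> \<Omega> \<Longrightarrow> u x = 0"
    and H_square: "integrable lborel (\<lambda>x. (u x)\<^sup>2)"
    and H_energy: "integrable (lborel \<Otimes>\<^sub>M lborel) (\<lambda>(x, y). (u x - u y)\<^sup>2 * kernel_k (x - y))"
  using assms by (auto simp: H_space_def)

lemma H_mult_integrable: "u \<in> H \<Longrightarrow> v \<in> H \<Longrightarrow> integrable lborel (\<lambda>x. u x * v x)"
  using integrable_mult_of_squares[of u lborel v] H_measurable H_square by simp

text \<open>As \<open>\<Omega>\<close> has finite measure, square integrable functions on it are integrable.\<close>

lemma H_abs_bound: "u \<in> H \<Longrightarrow> \<bar>u x\<bar> \<le> indicator \<Omega> x + (u x)\<^sup>2"
  using H_zero[of u x] sum_squares_bound[of 1 "\<bar>u x\<bar>"]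
  by (cases "x \<in> \<Omega>") auto

lemma H_integrable:
  assumes "u \<in> H"
  shows "integrable lborel u"
proof (rule Bochner_Integration.integrable_bound)
  show "integrable lborel (\<lambda>x. indicator \<Omega> x + (u x)\<^sup>2)"
    using integrable_indicator_domain H_square[OF assms] by simp
  show "AE x in lborel. norm (u x) \<le> norm (indicator \<Omega> x + (u x)\<^sup>2)"
    using H_abs_bound[OF assms] by (auto intro!: AE_I2)
qed (use H_measurable[OF assms] in simp)

lemma energy_integrable:
  assumes "u \<in> H" "v \<in> H"
  shows "integrable (lborel \<Otimes>\<^sub>M lborel)
    (\<lambda>p. (u (fst p) - u (snd p)) * (v (fst p) - v (snd p)) * kernel_k (fst p - snd p))"
proof -
  note [measurable] = H_measurable[OF assms(1)] H_measurable[OF assms(2)]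
  have "integrable (lborel \<Otimes>\<^sub>M lborel)
    (\<lambda>p. ((u (fst p) - u (snd p)) * sqrt (kernel_k (fst p - snd p))) *
          ((v (fst p) - v (snd p)) * sqrt (kernel_k (fst p - snd p))))"
    using H_energy[OF assms(1)] H_energy[OF assms(2)]
    by (intro integrable_mult_of_squares)
       (auto simp: power_mult_distrib kernel_k_nonneg case_prod_beta')
  moreover have "((u (fst p) - u (snd p)) * sqrt (kernel_k (fst p - snd p))) *
          ((v (fst p) - v (snd p)) * sqrt (kernel_k (fst p - snd p))) =
     (u (fst p) - u (snd p)) * (v (fst p) - v (snd p)) * kernel_k (fst p - snd p)" for p
    using real_sqrt_mult_self[of "kernel_k (fst p - snd p)"] kernel_k_nonneg[of "fst p - snd p"]
    by (simp add: algebra_simps)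
  ultimately show ?thesis by simp
qed

lemma far_integrable:
  assumes "u \<in> H" "v \<in> H"
  shows "integrable (lborel \<Otimes>\<^sub>M lborel) (\<lambda>p. u (fst p) * v (snd p) * kernel_j (fst p - snd p))"
proof (rule Bochner_Integration.integrable_bound)
  note [measurable] = H_measurable[OF assms(1)] H_measurable[OF assms(2)]
  show "integrable (lborel \<Otimes>\<^sub>M lborel) (\<lambda>(x, y). u x * v y)"
    by (intro lborel_pair.integrable_product_mult H_integrable assms)
  show "AE p in lborel \<Otimes>\<^sub>M lborel. norm (u (fst p) * v (snd p) * kernel_j (fst p - snd p))
      \<le> norm (case p of (x, y) \<Rightarrow> u x * v y)"
    by (intro AE_I2)
      (simp add: abs_mult case_prod_beta' mult_left_le kernel_j_le_1 kernel_j_nonneg)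
qed (use assms H_measurable in measurable)

lemma H_lin_closed:
  assumes "u \<in> H" "v \<in> H"
  shows "(\<lambda>x. a * u x + b * v x) \<in> H"
proof -
  note [measurable] = H_measurable[OF assms(1)] H_measurable[OF assms(2)]
  let ?w = "\<lambda>x. a * u x + b * v x"
  have "integrable lborel (\<lambda>x. a\<^sup>2 * (u x)\<^sup>2 + 2 * a * b * (u x * v x) + b\<^sup>2 * (v x)\<^sup>2)"
    using assms H_square H_mult_integrable by simp
  then have 1: "integrable lborel (\<lambda>x. (?w x)\<^sup>2)"
    by (simp add: power2_sum power_mult_distrib algebra_simps)
  have "integrable (lborel \<Otimes>\<^sub>M lborel) (\<lambda>p.
      a\<^sup>2 * ((u (fst p) - u (snd p)) * (u (fst p) - u (snd p)) * kernel_k (fst p - snd p))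
     + 2 * a * b * ((u (fst p) - u (snd p)) * (v (fst p) - v (snd p)) * kernel_k (fst p - snd p))
     + b\<^sup>2 * ((v (fst p) - v (snd p)) * (v (fst p) - v (snd p)) * kernel_k (fst p - snd p)))"
    by (intro Bochner_Integration.integrable_add integrable_mult_right energy_integrable assms)
  also have "(\<lambda>p.
      a\<^sup>2 * ((u (fst p) - u (snd p)) * (u (fst p) - u (snd p)) * kernel_k (fst p - snd p))
     + 2 * a * b * ((u (fst p) - u (snd p)) * (v (fst p) - v (snd p)) * kernel_k (fst p - snd p))
     + b\<^sup>2 * ((v (fst p) - v (snd p)) * (v (fst p) - v (snd p)) * kernel_k (fst p - snd p)))
     = (\<lambda>(x, y). (?w x - ?w y)\<^sup>2 * kernel_k (x - y))"
    by (intro ext) (simp add: case_prod_beta' power2_eq_square algebra_simps)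
  finally show ?thesis
    using 1 H_zero[OF assms(1)] H_zero[OF assms(2)]
    unfolding H_space_def mem_Collect_eq by (intro conjI) auto
qed

lemma energy_symmetric: "symmetric_form H energy"
proof
  fix u v w a b assume A: "u \<in> H" "v \<in> H" and W: "w \<in> H"
  have "(\<integral>p. a * ((u (fst p) - u (snd p)) * (w (fst p) - w (snd p)) * kernel_k (fst p - snd p))
     + b * ((v (fst p) - v (snd p)) * (w (fst p) - w (snd p)) * kernel_k (fst p - snd p))
       \<partial>(lborel \<Otimes>\<^sub>M lborel)) = 
     a * (\<integral>p. (u (fst p) - u (snd p)) * (w (fst p) - w (snd p)) * kernel_k (fst p - snd p)
       \<partial>(lborel \<Otimes>\<^sub>M lborel))
     + b * (\<integral>p. (v (fst p) - v (snd p)) * (w (fst p) - w (snd p)) * kernel_k (fst p - snd p)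
       \<partial>(lborel \<Otimes>\<^sub>M lborel))"
    using energy_integrable[OF A(1) W] energy_integrable[OF A(2) W] by simp
  then show "energy (\<lambda>x. a * u x + b * v x) w = a * energy u w + b * energy v w"
    unfolding energy_def case_prod_beta' by (simp add: algebra_simps)
qed (auto intro: H_lin_closed simp: energy_def algebra_simps)

lemma l2_symmetric: "symmetric_form H l2"
proof
  fix u v w a b assume A: "u \<in> H" "v \<in> H" "w \<in> H"
  have "(\<integral>x. a * (u x * w x) + b * (v x * w x) \<partial>lborel)
     = a * (\<integral>x. u x * w x \<partial>lborel) + b * (\<integral>x. v x * w x \<partial>lborel)"
    using H_mult_integrable[OF A(1,3)] H_mult_integrable[OF A(2,3)] by simp
  then show "l2 (\<lambda>x. a * u x + b * v x) w = a * l2 u w + b * l2 v w"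
    unfolding l2_def by (simp add: algebra_simps)
qed (auto intro: H_lin_closed simp: l2_def algebra_simps)

lemma far_form_symmetric: "symmetric_form H far_form"
proof
  fix u v w a b assume A: "u \<in> H" "v \<in> H" 
  have "far_form u v = (\<integral>(y, x). (\<lambda>p. u (fst p) * v (snd p) * kernel_j (fst p - snd p)) (x, y)
      \<partial>(lborel \<Otimes>\<^sub>M lborel))"
    unfolding far_form_def
    by (subst lborel_pair.integral_product_swap[symmetric])
       (use H_measurable[OF A(1)] H_measurable[OF A(2)] in \<open>auto simp: case_prod_beta'\<close>)
  also have "\<dots> = far_form v u"
    unfolding far_form_def
    by (intro Bochner_Integration.integral_cong refl)
       (auto simp: kernel_j_minus[of "_ - _", simplified] algebra_simps)
  finally show "far_form u v = far_form v u" .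
next
  fix u v w a b assume A: "u \<in> H" "v \<in> H" and W: "w \<in> H"
  have "(\<integral>p. a * (u (fst p) * w (snd p) * kernel_j (fst p - snd p))
     + b * (v (fst p) * w (snd p) * kernel_j (fst p - snd p)) \<partial>(lborel \<Otimes>\<^sub>M lborel)) = 
     a * (\<integral>p. u (fst p) * w (snd p) * kernel_j (fst p - snd p) \<partial>(lborel \<Otimes>\<^sub>M lborel))
     + b * (\<integral>p. v (fst p) * w (snd p) * kernel_j (fst p - snd p) \<partial>(lborel \<Otimes>\<^sub>M lborel))"
    using far_integrable[OF A(1) W] far_integrable[OF A(2) W] by simp
  then show "far_form (\<lambda>x. a * u x + b * v x) w = a * far_form u w + b * far_form v w"
    unfolding far_form_def case_prod_beta' by (simp add: algebra_simps)
qed (auto intro: H_lin_closed)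

sublocale energy: nonneg_form H energy
proof -
  interpret symmetric_form H energy by (rule energy_symmetric)
  show "nonneg_form H energy"
    by unfold_locales
      (auto simp: energy_def kernel_k_nonneg power2_eq_square[symmetric]
        intro!: mult_nonneg_nonneg integral_nonneg_AE less_imp_le[OF log_lap_c_pos])
qed

sublocale l2: nonneg_form H l2
proof -
  interpret symmetric_form H l2 by (rule l2_symmetric)
  show "nonneg_form H l2" by unfold_locales (simp add: l2_def)
qed

sublocale low: symmetric_form H low_form
  unfolding low_form_def[abs_def] by (intro symmetric_form_combine far_form_symmetric l2_symmetric)

sublocale energy_L: symmetric_form H energy_L
  using symmetric_form_combine[OF energy_symmetric low.symmetric_form_axioms, of 1 1]
  by (simp add: energy_L_decompose[abs_def])

text \<open>
  The kernel \<open>j\<close> is bounded by 1, so by \<open>|u(x) u(y)| \<le> (u(x)\<^sup>2 1\<^sub>\<Omega>(y) + 1\<^sub>\<Omega>(x) u(y)\<^sup>2) / 2\<close>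
  the far interaction is a bounded form on \<open>L\<^sup>2\<close>.
\<close>

lemma far_form_bound:
  assumes "u \<in> H"
  shows "\<bar>far_form u u\<bar> \<le> measure lborel \<Omega> * l2 u u"
proof -
  note [measurable] = H_measurable[OF assms]
  have i: "integrable (lborel \<Otimes>\<^sub>M lborel) (\<lambda>p. (u (fst p))\<^sup>2 * indicator \<Omega> (snd p))"
     "integrable (lborel \<Otimes>\<^sub>M lborel) (\<lambda>p. indicator \<Omega> (fst p) * (u (snd p))\<^sup>2)"
    using lborel_pair.integrable_product_mult[OF H_square[OF assms] integrable_indicator_domain]
      lborel_pair.integrable_product_mult[OF integrable_indicator_domain H_square[OF assms]]
    by (simp_all add: case_prod_beta')
  have "\<bar>far_form u u\<bar> \<le> (\<integral>p. \<bar>u (fst p) * u (snd p) * kernel_j (fst p - snd p)\<bar>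
      \<partial>(lborel \<Otimes>\<^sub>M lborel))"
    unfolding far_form_def case_prod_beta' by (rule integral_abs_bound)
  also have "\<dots> \<le> (\<integral>p. ((u (fst p))\<^sup>2 * indicator \<Omega> (snd p)
      + indicator \<Omega> (fst p) * (u (snd p))\<^sup>2) / 2 \<partial>(lborel \<Otimes>\<^sub>M lborel))"
  proof (rule integral_mono)
    fix p :: "(real ^ 'n) \<times> (real ^ 'n)"
    have "\<bar>u (fst p) * u (snd p) * kernel_j (fst p - snd p)\<bar> \<le> \<bar>u (fst p) * u (snd p)\<bar>"
      by (simp add: abs_mult mult_left_le kernel_j_le_1 kernel_j_nonneg)
    also have "\<dots> \<le> ((u (fst p))\<^sup>2 * indicator \<Omega> (snd p)
      + indicator \<Omega> (fst p) * (u (snd p))\<^sup>2) / 2"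
      using H_zero[OF assms, of "fst p"] H_zero[OF assms, of "snd p"]
        sum_squares_bound[of "\<bar>u (fst p)\<bar>" "\<bar>u (snd p)\<bar>"]
      by (cases "fst p \<in> \<Omega>"; cases "snd p \<in> \<Omega>") (auto simp: abs_mult)
    finally show "\<bar>u (fst p) * u (snd p) * kernel_j (fst p - snd p)\<bar> \<le> \<dots>" .
  qed (use i far_integrable[OF assms assms] in auto)
  also have "\<dots> = ((\<integral>p. (u (fst p))\<^sup>2 * indicator \<Omega> (snd p) \<partial>(lborel \<Otimes>\<^sub>M lborel))
     + (\<integral>p. indicator \<Omega> (fst p) * (u (snd p))\<^sup>2 \<partial>(lborel \<Otimes>\<^sub>M lborel))) / 2"
    using i by simp
  also have "\<dots> = measure lborel \<Omega> * l2 u u"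
    using lborel_pair.integral_fst'[OF i(1)] lborel_pair.integral_fst'[OF i(2)]
    by (simp add: l2_def power2_eq_square mult.commute)
  finally show ?thesis .
qed

lemma low_form_bound: "\<exists>M>0. \<forall>u\<in>H. \<bar>low_form u u\<bar> \<le> M * l2 u u"
proof (intro exI conjI ballI)
  let ?M = "log_lap_c CARD('n) * measure lborel \<Omega> + \<bar>log_lap_rho CARD('n)\<bar>"
  show "?M + 1 > 0" using log_lap_c_pos[where 'n='n] by (simp add: add_nonneg_pos)
  fix u assume u: "u \<in> H"
  have "\<bar>low_form u u\<bar> \<le> log_lap_c CARD('n) * \<bar>far_form u u\<bar> + \<bar>log_lap_rho CARD('n)\<bar> * l2 u u"
    using l2.nonneg[OF u] log_lap_c_pos[where 'n='n]
    unfolding low_form_def by (intro order_trans[OF abs_triangle_ineq]) (simp add: abs_mult)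
  also have "\<dots> \<le> ?M * l2 u u"
    using mult_left_mono[OF far_form_bound[OF u], of "log_lap_c CARD('n)"] log_lap_c_pos[where 'n='n]
    by (simp add: algebra_simps)
  also have "\<dots> \<le> (?M + 1) * l2 u u" using l2.nonneg[OF u] by (simp add: algebra_simps)
  finally show "\<bar>low_form u u\<bar> \<le> (?M + 1) * l2 u u" .
qed

lemma null_iff_l2:
  assumes "u \<in> H"
  shows "(AE x in lborel. u x = 0) \<longleftrightarrow> l2 u u = 0"
  using integral_nonneg_eq_0_iff_AE[of lborel "\<lambda>x. u x * u x"] H_mult_integrable[OF assms assms]
  by (simp add: l2_def)

lemma set_integral_l2:
  "u \<in> H \<Longrightarrow> (LINT x:\<Omega>|lborel. u x * v x) = l2 u v"
  unfolding l2_def set_lebesgue_integral_def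
  by (intro Bochner_Integration.integral_cong refl) (auto simp: indicator_def H_zero)

end

section \<open>Closedness of the energy under convergence in mean square\<close>

lemma Fatou_real:
  fixes f :: "nat \<Rightarrow> 'a \<Rightarrow> real"
  assumes int: "\<And>n. integrable M (f n)" and pos: "\<And>n x. f n x \<ge> 0"
    and g: "g \<in> borel_measurable M" and g_pos: "\<And>x. g x \<ge> 0"
    and lim: "AE x in M. (\<lambda>n. f n x) \<longlonglongrightarrow> g x"
    and bound: "\<forall>\<^sub>F n in sequentially. integral\<^sup>L M (f n) \<le> C"
  shows "integrable M g" and "integral\<^sup>L M g \<le> C"
proof -
  obtain n where "integral\<^sup>L M (f n) \<le> C"
    using bound eventually_happens by force
  then have C: "C \<ge> 0"
    using pos by (meson Bochner_Integration.integral_nonneg order_trans)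
  have "(\<integral>\<^sup>+ x. ennreal (g x) \<partial>M) = (\<integral>\<^sup>+ x. liminf (\<lambda>n. ennreal (f n x)) \<partial>M)"
  proof (rule nn_integral_cong_AE)
    show "AE x in M. ennreal (g x) = liminf (\<lambda>n. ennreal (f n x))"
      using lim by eventually_elim (auto intro!: lim_imp_Liminf[symmetric] tendsto_ennrealI)
  qed
  also have "\<dots> \<le> liminf (\<lambda>n. \<integral>\<^sup>+ x. ennreal (f n x) \<partial>M)"
    using int by (intro nn_integral_liminf) auto
  also have "\<dots> = liminf (\<lambda>n. ennreal (integral\<^sup>L M (f n)))"
    using int pos by (simp add: nn_integral_eq_integral)
  also have "\<dots> \<le> liminf (\<lambda>n. ennreal C)"
    using bound by (intro Liminf_mono) (auto elim!: eventually_mono intro: ennreal_leI)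
  also have "\<dots> = ennreal C" by (simp add: Liminf_const)
  finally have *: "(\<integral>\<^sup>+ x. ennreal (g x) \<partial>M) \<le> ennreal C" .
  show "integrable M g"
    using * g g_pos by (intro integrableI_nonneg) (auto intro: le_less_trans)
  then show "integral\<^sup>L M g \<le> C"
    using * g_pos C by (simp add: nn_integral_eq_integral)
qed

text \<open>
  On a set of finite measure, \<open>|d| \<le> 2\<^sup>-\<^sup>n + 2\<^sup>n d\<^sup>2\<close> turns a geometric rate in mean square into
  a geometric rate in mean, and a series converging absolutely in mean converges pointwise.
\<close>

lemma AE_summable_of_square_integrals:
  fixes d :: "nat \<Rightarrow> 'a \<Rightarrow> real"
  assumes meas [measurable]: "\<And>n. d n \<in> borel_measurable M" and A [measurable]: "A \<in> sets M"
    and fin: "emeasure M A < \<infinity>" and zero: "\<And>n x. x \<notin> A \<Longrightarrow> d n x = 0"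
    and int: "\<And>n. integrable M (\<lambda>x. (d n x)\<^sup>2)"
    and small: "\<And>n. (\<integral>x. (d n x)\<^sup>2 \<partial>M) \<le> (1/4) ^ n"
  shows "AE x in M. summable (\<lambda>n. d n x)"
proof -
  have bound: "\<bar>d n x\<bar> \<le> (1/2) ^ n * indicator A x + 2 ^ n * (d n x)\<^sup>2" for n x
  proof -
    show ?thesis
    proof (cases "x \<in> A")
      case True
      \<comment> \<open>The rescaled elementary bound \<open>t \<le> 1 + t\<^sup>2\<close>.\<close>
      define t where "t = 2 ^ n * \<bar>d n x\<bar>"
      have "2 * t \<le> 1 + t\<^sup>2" using sum_squares_bound[of 1 t] by simp
      moreover have "0 \<le> t" by (simp add: t_def)
      ultimately have "t \<le> 1 + t\<^sup>2" by linarith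
      then have "2 ^ n * \<bar>d n x\<bar> \<le> 1 + (2 ^ n * \<bar>d n x\<bar>)\<^sup>2" by (simp only: t_def)
      then have "(1/2) ^ n * (2 ^ n * \<bar>d n x\<bar>) \<le> (1/2) ^ n * (1 + (2 ^ n * \<bar>d n x\<bar>)\<^sup>2)"
        by (intro mult_left_mono) simp_all
      also have "\<dots> = (1/2) ^ n + (1/2) ^ n * (2 ^ n * 2 ^ n) * (d n x)\<^sup>2"
        by (simp add: power2_eq_square algebra_simps)
      also have "(1/2) ^ n * (2 ^ n * 2 ^ n) = (2 :: real) ^ n"
        by (simp add: power_one_over)
      finally show ?thesis using True by (simp add: power_one_over)
    qed (simp add: zero)
  qed
  have ind: "integrable M (indicator A :: 'a \<Rightarrow> real)"
    using fin by (intro integrable_real_indicator) auto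
  have int1: "integrable M (\<lambda>x. (1/2) ^ n * indicator A x + 2 ^ n * (d n x)\<^sup>2)" for n
    using ind int[of n] by simp
  have int2: "integrable M (\<lambda>x. \<bar>d n x\<bar>)" for n
    by (rule Bochner_Integration.integrable_bound[OF int1[of n]])
       (use bound[of n] in \<open>auto intro!: AE_I2 order_trans[OF _ abs_ge_self]\<close>)
  have "(\<integral>x. \<bar>d n x\<bar> \<partial>M) \<le> (measure M A + 1) * (1/2) ^ n" for n
  proof -
    have "(\<integral>x. \<bar>d n x\<bar> \<partial>M) \<le> (\<integral>x. (1/2) ^ n * indicator A x + 2 ^ n * (d n x)\<^sup>2 \<partial>M)"
      by (intro integral_mono int1 int2 bound)
    also have "\<dots> = (1/2) ^ n * measure M A + 2 ^ n * (\<integral>x. (d n x)\<^sup>2 \<partial>M)"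
      using ind int[of n] by simp
    also have "\<dots> \<le> (1/2) ^ n * measure M A + 2 ^ n * (1/4) ^ n"
      using small[of n] by simp
    also have "(2::real) ^ n * (1/4) ^ n = (1/2) ^ n" by (simp flip: power_mult_distrib)
    finally show ?thesis by (simp add: algebra_simps)
  qed
  then have le: "norm (\<integral>x. \<bar>d n x\<bar> \<partial>M) \<le> (measure M A + 1) * (1/2) ^ n" for n
    by (subst real_norm_def, subst abs_of_nonneg) auto
  have "summable (\<lambda>n. (measure M A + 1) * (1/2) ^ n)"
    by (intro summable_mult summable_geometric) simp
  then have sm: "summable (\<lambda>n. \<integral>x. \<bar>d n x\<bar> \<partial>M)"
    by (rule summable_comparison_test'[where N=0]) (rule le)
  have "(\<integral>\<^sup>+ x. (\<Sum>n. ennreal \<bar>d n x\<bar>) \<partial>M) = (\<Sum>n. \<integral>\<^sup>+ x. ennreal \<bar>d n x\<bar> \<partial>M)"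
    by (intro nn_integral_suminf) measurable
  also have "\<dots> = (\<Sum>n. ennreal (\<integral>x. \<bar>d n x\<bar> \<partial>M))"
    using int2 by (simp add: nn_integral_eq_integral)
  also have "\<dots> \<noteq> \<infinity>"
    unfolding infinity_ennreal_def by (rule ennreal_suminf_neq_top[OF sm]) simp
  finally have "AE x in M. (\<Sum>n. ennreal \<bar>d n x\<bar>) \<noteq> \<infinity>"
    by (intro nn_integral_PInf_AE) auto
  then show ?thesis
  proof eventually_elim
    case (elim x)
    have "summable (\<lambda>n. \<bar>d n x\<bar>)"
      by (rule summable_suminf_not_top) (use elim in auto)
    then show ?case by (rule summable_rabs_cancel)
  qed
qed

text \<open>
  The exceptional pairs lie in the product of a null set with the whole space, in one order or the
  other.
\<close>

lemma AE_pair_both: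
  fixes P :: "'a::euclidean_space \<Rightarrow> bool"
  assumes "AE x in lborel. P x"
  shows "AE p in lborel \<Otimes>\<^sub>M lborel. P (fst p) \<and> P (snd p)"
proof -
  obtain N where N: "\<And>x. x \<in> space lborel - N \<Longrightarrow> P x" "N \<in> null_sets lborel"
    using AE_E3[OF assms] by blast
  then have AE_N: "AE x in lborel. x \<notin> N" and [measurable]: "N \<in> sets lborel"
    by (auto intro: AE_not_in)
  have "AE p in lborel \<Otimes>\<^sub>M lborel. fst p \<notin> N \<and> snd p \<notin> N"
  proof (rule lborel_pair.AE_pair_measure)
    show "{p \<in> space (lborel \<Otimes>\<^sub>M lborel). fst p \<notin> N \<and> snd p \<notin> N} \<in> sets (lborel \<Otimes>\<^sub>M lborel)"
      by measurable
    show "AE x in lborel. AE y in lborel. fst (x, y) \<notin> N \<and> snd (x, y) \<notin> N"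
      using AE_N by eventually_elim (use AE_N in \<open>auto elim: eventually_mono\<close>)
  qed
  then show ?thesis by (rule eventually_mono) (use N(1) in auto)
qed

context bounded_domain
begin

text \<open>
  The integrand of the energy is nonnegative, so the energy is lower semicontinuous for almost
  everywhere convergence.
\<close>

lemma energy_Fatou:
  assumes f: "\<And>n. f n \<in> H" and u [measurable]: "u \<in> borel_measurable borel"
    and lim: "AE x in lborel. (\<lambda>n. f n x) \<longlonglongrightarrow> u x"
    and bound: "\<forall>\<^sub>F n in sequentially. energy (f n) (f n) \<le> C"
  shows "integrable (lborel \<Otimes>\<^sub>M lborel) (\<lambda>(x, y). (u x - u y)\<^sup>2 * kernel_k (x - y))"
    and "energy u u \<le> C"
proof -
  let ?c = "log_lap_c CARD('n) / 2"
  have c: "?c > 0" using log_lap_c_pos[where 'n='n] by simp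
  have energy_eq: "energy v v = ?c * (\<integral>(x, y). (v x - v y)\<^sup>2 * kernel_k (x - y)
      \<partial>(lborel \<Otimes>\<^sub>M lborel))" for v :: "real ^ 'n \<Rightarrow> real"
    by (simp add: energy_def power2_eq_square)
  have 1: "AE p in lborel \<Otimes>\<^sub>M lborel.
      (\<lambda>n. case p of (x, y) \<Rightarrow> (f n x - f n y)\<^sup>2 * kernel_k (x - y))
        \<longlonglongrightarrow> (case p of (x, y) \<Rightarrow> (u x - u y)\<^sup>2 * kernel_k (x - y))"
    using AE_pair_both[OF lim]
    by eventually_elim (auto simp: case_prod_beta' intro!: tendsto_intros)
  have 2: "\<forall>\<^sub>F n in sequentially. (\<integral>(x, y). (f n x - f n y)\<^sup>2 * kernel_k (x - y)
      \<partial>(lborel \<Otimes>\<^sub>M lborel)) \<le> C / ?c"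
    using bound by eventually_elim
      (use c in \<open>simp add: energy_eq pos_le_divide_eq mult.commute del: times_divide_eq_left times_divide_eq_right divide_divide_eq_right\<close>)
  note F = Fatou_real[where f="\<lambda>n (x, y). (f n x - f n y)\<^sup>2 * kernel_k (x - y)",
      OF H_energy[OF f] _ _ _ 1 2]
  show "integrable (lborel \<Otimes>\<^sub>M lborel) (\<lambda>(x, y). (u x - u y)\<^sup>2 * kernel_k (x - y))"
    by (rule F(1)) (auto simp: kernel_k_nonneg)
  have "(\<integral>(x, y). (u x - u y)\<^sup>2 * kernel_k (x - y) \<partial>(lborel \<Otimes>\<^sub>M lborel)) \<le> C / ?c"
    by (rule F(2)) (auto simp: kernel_k_nonneg)
  then show "energy u u \<le> C"
    using c by (simp add: energy_eq pos_le_divide_eq mult.commute del: times_divide_eq_left times_divide_eq_right divide_divide_eq_right)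
qed

text \<open>
  The subsequence is chosen so sparse that its successive differences fulfil the geometric rate
  above, and its limit is the sum of the telescoping series.
\<close>

lemma L2_Cauchy_AE_subsequence:
  assumes f: "\<And>n. f n \<in> H"
    and Cauchy: "\<And>e. e > 0 \<Longrightarrow> \<exists>N. \<forall>m\<ge>N. \<forall>n\<ge>N. l2 (\<lambda>x. f m x - f n x) (\<lambda>x. f m x - f n x) \<le> e"
  obtains r :: "nat \<Rightarrow> nat" and u where "strict_mono r" "u \<in> borel_measurable borel"
    "\<And>x. x \<notin> \<Omega> \<Longrightarrow> u x = 0" "AE x in lborel. (\<lambda>n. f (r n) x) \<longlonglongrightarrow> u x"
proof -
  have "\<forall>k. \<exists>N. \<forall>m\<ge>N. \<forall>n\<ge>N. l2 (\<lambda>x. f m x - f n x) (\<lambda>x. f m x - f n x) \<le> (1/4) ^ k"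
    by (intro allI Cauchy) simp
  then obtain N where N: "\<And>k m n. m \<ge> N k \<Longrightarrow> n \<ge> N k \<Longrightarrow>
      l2 (\<lambda>x. f m x - f n x) (\<lambda>x. f m x - f n x) \<le> (1/4) ^ k"
    by metis
  \<comment> \<open>The sum makes \<open>r k \<ge> N k\<close>, the summand \<open>k\<close> makes \<open>r\<close> strictly increasing.\<close>
  define r where "r k = (\<Sum>i\<le>k. N i) + k" for k
  have r: "strict_mono r" by (simp add: strict_mono_Suc_iff r_def)
  have rN: "r k \<ge> N k" for k by (simp add: r_def member_le_sum trans_le_add1)
  define d where "d k x = f (r (Suc k)) x - f (r k) x" for k x
  have d_H: "d k \<in> H" for k unfolding d_def[abs_def] by (intro l2.diff_closed f)
  have "AE x in lborel. summable (\<lambda>k. d k x)"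
  proof (rule AE_summable_of_square_integrals[where A=\<Omega>])
    show "(\<integral>x. (d k x)\<^sup>2 \<partial>lborel) \<le> (1/4) ^ k" for k
    proof -
      have "r (Suc k) \<ge> N k" using rN[of k] strict_mono_less_eq[OF r, of k "Suc k"] by simp
      then show ?thesis
        using N[of k "r (Suc k)" "r k"] rN[of k] by (simp add: l2_def d_def power2_eq_square)
    qed
  qed (use d_H H_measurable H_zero H_square emeasure_domain in auto)
  then have conv: "AE x in lborel. convergent (\<lambda>k. f (r k) x)"
  proof eventually_elim
    case (elim x)
    have "(\<lambda>k. f (r k) x) = (\<lambda>k. f (r 0) x + (\<Sum>i<k. d i x))"
      by (simp add: d_def sum_lessThan_telescope[of "\<lambda>i. f (r i) x"])
    moreover have "convergent (\<lambda>k. f (r 0) x + (\<Sum>i<k. d i x))"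
      using elim by (simp add: summable_iff_convergent convergent_add_const_iff)
    ultimately show ?case by (simp only:)
  qed
  note [measurable] = H_measurable[OF f]
  show thesis
  proof
    show "(\<lambda>x. lim (\<lambda>k. f (r k) x)) \<in> borel_measurable borel"
      by (intro borel_measurable_lim_metric) measurable
    show "lim (\<lambda>k. f (r k) x) = 0" if "x \<notin> \<Omega>" for x
      using H_zero[OF f that] by (simp add: limI)
    show "AE x in lborel. (\<lambda>k. f (r k) x) \<longlonglongrightarrow> lim (\<lambda>k. f (r k) x)"
      using conv by eventually_elim (simp add: convergent_LIMSEQ_iff)
  qed (rule r)
qed

text \<open>
  Fatou's lemma puts the limit into \<open>H(\<Omega>)\<close> and turns the Cauchy property into convergence.
\<close>

lemma L2_Cauchy_limit:
  assumes f: "\<And>n. f n \<in> H" and bound: "\<And>n. energy (f n) (f n) \<le> M" "\<And>n. l2 (f n) (f n) \<le> M"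
    and Cauchy: "\<And>e. e > 0 \<Longrightarrow> \<exists>N. \<forall>m\<ge>N. \<forall>n\<ge>N. l2 (\<lambda>x. f m x - f n x) (\<lambda>x. f m x - f n x) \<le> e"
  obtains r :: "nat \<Rightarrow> nat" and u where "strict_mono r" "u \<in> H"
    "AE x in lborel. (\<lambda>n. f (r n) x) \<longlonglongrightarrow> u x"
    "(\<lambda>n. l2 (\<lambda>x. f (r n) x - u x) (\<lambda>x. f (r n) x - u x)) \<longlonglongrightarrow> 0"
proof -
  obtain r u where r: "strict_mono r" and u [measurable]: "u \<in> borel_measurable borel"
    and u0: "\<And>x. x \<notin> \<Omega> \<Longrightarrow> u x = 0" and lim: "AE x in lborel. (\<lambda>n. f (r n) x) \<longlonglongrightarrow> u x"
    by (rule L2_Cauchy_AE_subsequence[of f, OF f Cauchy]) (assumption, rule that)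
  have sq: "integrable lborel (\<lambda>x. (u x)\<^sup>2)"
  proof (rule Fatou_real(1))
    show "integrable lborel (\<lambda>x. (f (r n) x)\<^sup>2)" for n by (rule H_square[OF f])
    show "AE x in lborel. (\<lambda>n. (f (r n) x)\<^sup>2) \<longlonglongrightarrow> (u x)\<^sup>2"
      using lim by eventually_elim (intro tendsto_intros)
    show "\<forall>\<^sub>F n in sequentially. (\<integral>x. (f (r n) x)\<^sup>2 \<partial>lborel) \<le> M"
      using bound(2) by (simp add: l2_def power2_eq_square)
  qed auto
  have "integrable (lborel \<Otimes>\<^sub>M lborel) (\<lambda>(x, y). (u x - u y)\<^sup>2 * kernel_k (x - y))"
    by (rule energy_Fatou(1)[OF f u lim, where C=M]) (use bound(1) in auto)
  then have u_H: "u \<in> H" using sq u0 u by (simp add: H_space_def)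
  have "(\<lambda>n. l2 (\<lambda>x. f (r n) x - u x) (\<lambda>x. f (r n) x - u x)) \<longlonglongrightarrow> 0"
  proof (rule LIMSEQ_I)
    fix e :: real assume "e > 0"
    then obtain N where N: "\<And>m n. m \<ge> N \<Longrightarrow> n \<ge> N \<Longrightarrow>
        l2 (\<lambda>x. f m x - f n x) (\<lambda>x. f m x - f n x) \<le> e / 2"
      using Cauchy[of "e / 2"] by auto
    have "l2 (\<lambda>x. f (r n) x - u x) (\<lambda>x. f (r n) x - u x) \<le> e / 2" if "n \<ge> N" for n
    proof -
      have "(\<integral>x. (f (r n) x - u x)\<^sup>2 \<partial>lborel) \<le> e / 2"
      proof (rule Fatou_real(2))
        show "integrable lborel (\<lambda>x. (f (r n) x - f (r m) x)\<^sup>2)" for m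
          by (intro H_square l2.diff_closed f)
        show "AE x in lborel. (\<lambda>m. (f (r n) x - f (r m) x)\<^sup>2) \<longlonglongrightarrow> (f (r n) x - u x)\<^sup>2"
          using lim by eventually_elim (intro tendsto_intros)
        show "\<forall>\<^sub>F m in sequentially. (\<integral>x. (f (r n) x - f (r m) x)\<^sup>2 \<partial>lborel) \<le> e / 2"
          using eventually_ge_at_top[of N]
        proof eventually_elim
          case (elim m)
          have "r m \<ge> N" "r n \<ge> N"
            using elim that seq_suble[OF r, of m] seq_suble[OF r, of n] by linarith+
          then show ?case using N[of "r n" "r m"] by (simp add: l2_def power2_eq_square)
        qed
      qed (use H_measurable[OF f] in auto)
      then show ?thesis by (simp add: l2_def power2_eq_square)
    qed
    moreover have "l2 (\<lambda>x. f (r n) x - u x) (\<lambda>x. f (r n) x - u x) \<ge> 0" for n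
      by (intro l2.nonneg l2.diff_closed f u_H)
    ultimately show "\<exists>N. \<forall>n\<ge>N. norm (l2 (\<lambda>x. f (r n) x - u x) (\<lambda>x. f (r n) x - u x) - 0) < e"
      using \<open>e > 0\<close> by (intro exI[of _ N]) (auto intro: le_less_trans[of _ "e / 2"])
  qed
  with r u_H lim show thesis by (rule that)
qed

end

section \<open>The Poincare inequality\<close>

lemma nn_integral_lborel_translate:
  fixes f :: "'a::euclidean_space \<Rightarrow> ennreal"
  assumes [measurable]: "f \<in> borel_measurable borel"
  shows "(\<integral>\<^sup>+ x. f (c + x) \<partial>lborel) = (\<integral>\<^sup>+ x. f x \<partial>lborel)"
proof -
  have "(\<integral>\<^sup>+ x. f x \<partial>lborel) = (\<integral>\<^sup>+ x. f x \<partial>(distr lborel borel ((+) c)))"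
    by (simp add: lborel_distr_plus)
  also have "\<dots> = (\<integral>\<^sup>+ x. f (c + x) \<partial>lborel)"
    by (rule nn_integral_distr) auto
  finally show ?thesis by simp
qed

text \<open>
  After \<open>m\<close> steps \<open>z\<close> from a point where \<open>u\<close> does not vanish, \<open>u\<close> vanishes, so its value at the
  start is the sum of the increments along the walk.
\<close>

lemma nn_integral_square_le_increment:
  fixes u :: "'a::euclidean_space \<Rightarrow> real"
  assumes [measurable]: "u \<in> borel_measurable borel"
    and exit: "\<And>x. u x \<noteq> 0 \<Longrightarrow> u (x + real m *\<^sub>R z) = 0"
  shows "(\<integral>\<^sup>+ x. ennreal ((u x)\<^sup>2) \<partial>lborel)
     \<le> ennreal ((real m)\<^sup>2) * (\<integral>\<^sup>+ x. ennreal ((u x - u (x + z))\<^sup>2) \<partial>lborel)"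
proof -
  let ?inc = "\<lambda>i x. (u (real i *\<^sub>R z + x) - u (real i *\<^sub>R z + x + z))\<^sup>2"
  have le: "(u x)\<^sup>2 \<le> real m * (\<Sum>i<m. ?inc i x)" for x
  proof (cases "u x = 0")
    case False
    have step: "real i *\<^sub>R z + x + z = real (Suc i) *\<^sub>R z + x" for i
      by (simp add: scaleR_left_distrib algebra_simps)
    have "(\<Sum>i<m. u (real i *\<^sub>R z + x) - u (real i *\<^sub>R z + x + z))
       = u (real 0 *\<^sub>R z + x) - u (real m *\<^sub>R z + x)"
      unfolding step by (rule sum_lessThan_telescope')
    also have "\<dots> = u x" using exit[OF False] by (simp add: add.commute)
    finally have "(u x)\<^sup>2 = (\<Sum>i<m. u (real i *\<^sub>R z + x) - u (real i *\<^sub>R z + x + z))\<^sup>2" by simp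
    also have "\<dots> \<le> (\<Sum>i<m. ?inc i x) * card {..<m}"
      by (rule sum_squared_le_sum_of_squares)
    finally show ?thesis by (simp add: mult.commute)
  qed (simp add: sum_nonneg)
  have split: "ennreal (real m * (\<Sum>i<m. ?inc i x)) = ennreal (real m) * (\<Sum>i<m. ennreal (?inc i x))"
    for x
    by (subst sum_ennreal, simp, subst ennreal_mult) (simp_all add: sum_nonneg)
  have "(\<integral>\<^sup>+ x. ennreal ((u x)\<^sup>2) \<partial>lborel)
     \<le> (\<integral>\<^sup>+ x. ennreal (real m) * (\<Sum>i<m. ennreal (?inc i x)) \<partial>lborel)"
    unfolding split[symmetric] by (intro nn_integral_mono ennreal_leI le)
  also have "\<dots> = ennreal (real m) * (\<Sum>i<m. \<integral>\<^sup>+ x. ennreal (?inc i x) \<partial>lborel)"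
    by (subst nn_integral_cmult, measurable, subst nn_integral_sum, measurable)
  also have "\<dots> = ennreal (real m) * (\<Sum>i<m. \<integral>\<^sup>+ x. ennreal ((u x - u (x + z))\<^sup>2) \<partial>lborel)"
    by (subst nn_integral_lborel_translate[of "\<lambda>x. ennreal ((u x - u (x + z))\<^sup>2)"]) auto
  also have "\<dots> = ennreal ((real m)\<^sup>2) * (\<integral>\<^sup>+ x. ennreal ((u x - u (x + z))\<^sup>2) \<partial>lborel)"
    by (simp add: power2_eq_square ennreal_mult ennreal_of_nat_eq_real_of_nat mult.assoc)
  finally show ?thesis .
qed

lemma nn_integral_pair_increments:
  fixes u :: "real ^ 'n \<Rightarrow> real"
  assumes [measurable]: "u \<in> borel_measurable borel"
  shows "(\<integral>\<^sup>+ p. ennreal ((u (fst p) - u (snd p))\<^sup>2 * kernel_k (fst p - snd p))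
      \<partial>(lborel \<Otimes>\<^sub>M lborel))
    = (\<integral>\<^sup>+ z. \<integral>\<^sup>+ x. ennreal ((u x - u (x + z))\<^sup>2 * kernel_k z) \<partial>lborel \<partial>lborel)"
proof -
  have "(\<integral>\<^sup>+ p. ennreal ((u (fst p) - u (snd p))\<^sup>2 * kernel_k (fst p - snd p))
      \<partial>(lborel \<Otimes>\<^sub>M lborel))
    = (\<integral>\<^sup>+ x. \<integral>\<^sup>+ y. ennreal ((u x - u y)\<^sup>2 * kernel_k (x - y)) \<partial>lborel \<partial>lborel)"
    by (subst lborel.nn_integral_fst[symmetric]) auto
  also have "\<dots> = (\<integral>\<^sup>+ x. \<integral>\<^sup>+ z. ennreal ((u x - u (x + z))\<^sup>2 * kernel_k z) \<partial>lborel \<partial>lborel)"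
  proof (rule nn_integral_cong)
    fix x
    show "(\<integral>\<^sup>+ y. ennreal ((u x - u y)\<^sup>2 * kernel_k (x - y)) \<partial>lborel)
      = (\<integral>\<^sup>+ z. ennreal ((u x - u (x + z))\<^sup>2 * kernel_k z) \<partial>lborel)"
      by (subst nn_integral_lborel_translate[of _ x, symmetric])
         (auto simp: kernel_k_minus)
  qed
  also have "\<dots> = (\<integral>\<^sup>+ z. \<integral>\<^sup>+ x. ennreal ((u x - u (x + z))\<^sup>2 * kernel_k z) \<partial>lborel \<partial>lborel)"
    by (rule lborel_pair.Fubini'[symmetric]) measurable
  finally show ?thesis .
qed

context bounded_domain
begin

definition pair_energy :: "(real ^ 'n \<Rightarrow> real) \<Rightarrow> real" where
  "pair_energy u = (\<integral>p. (u (fst p) - u (snd p))\<^sup>2 * kernel_k (fst p - snd p) \<partial>(lborel \<Otimes>\<^sub>M lborel))"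

lemma pair_energy_eq: "pair_energy u = 2 / log_lap_c CARD('n) * energy u u"
  using log_lap_c_pos[where 'n='n]
  by (simp add: pair_energy_def energy_def case_prod_beta' power2_eq_square)

text \<open>
  The increments along a fixed step \<open>z\<close> control the whole function as soon as \<open>z\<close> is not too
  short; averaging over a set of steps that the kernel sees turns this into a bound by the energy.
\<close>

lemma Poincare: "\<exists>C>0. \<forall>u\<in>H. l2 u u \<le> C * energy u u"
proof -
  obtain R where R: "R > 0" "\<And>x. x \<in> \<Omega> \<Longrightarrow> norm x \<le> R"
    using bounded_domain by (auto simp: bounded_pos)
  obtain m :: nat where m: "real m > 4 * R" using reals_Archimedean2 by blast
  \<comment> \<open>Steps between 1/2 and 1 are seen by the kernel, and \<open>m\<close> of them leave \<open>\<Omega>\<close>.\<close>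
  define A where "A = ball 0 1 - ball (0 :: real ^ 'n) (1/2)"
  have [measurable]: "A \<in> sets borel" by (simp add: A_def)
  define a where "a = measure lborel A"
  have A_fin: "emeasure lborel A < \<infinity>"
    unfolding A_def by (intro emeasure_bounded_finite bounded_diff) auto
  have "ball ((3/4) *\<^sub>R axis undefined 1) (1/4) \<subseteq> A"
  proof
    fix x assume "x \<in> ball ((3/4) *\<^sub>R axis undefined 1 :: real ^ 'n) (1/4)"
    moreover have "norm ((3/4) *\<^sub>R axis undefined 1 :: real ^ 'n) = 3/4" by simp
    ultimately show "x \<in> A"
      using norm_triangle_ineq2[of x "(3/4) *\<^sub>R axis undefined 1"]
        norm_triangle_ineq2[of "(3/4) *\<^sub>R axis undefined 1" x]
      unfolding A_def by (simp add: dist_norm norm_minus_commute)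
  qed
  then have "measure lborel (ball ((3/4) *\<^sub>R axis undefined 1 :: real ^ 'n) (1/4)) \<le> a"
    unfolding a_def using A_fin
    by (intro measure_mono_fmeasurable) (auto simp: fmeasurable_def)
  moreover have "0 < measure lborel (ball ((3/4) *\<^sub>R axis undefined 1 :: real ^ 'n) (1/4))"
    by (rule content_ball_pos) simp
  ultimately have a: "a > 0" by linarith
  have kA: "kernel_k z \<ge> 1" if "z \<in> A" for z
  proof -
    have "z \<noteq> 0" "norm z < 1" using that by (auto simp: A_def)
    then have "norm z ^ CARD('n) \<le> 1" "norm z ^ CARD('n) > 0"
      by (auto intro: power_le_one)
    then show ?thesis using \<open>norm z < 1\<close> by (simp add: kernel_k_def le_divide_eq)
  qed
  have main: "a * l2 u u \<le> (real m)\<^sup>2 * pair_energy u" if u: "u \<in> H" for u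
  proof -
    note [measurable] = H_measurable[OF u]
    have sq: "(\<integral>\<^sup>+ x. ennreal ((u x)\<^sup>2) \<partial>lborel) = ennreal (l2 u u)"
      using H_square[OF u] by (simp add: nn_integral_eq_integral l2_def power2_eq_square)
    have exit: "u (x + real m *\<^sub>R z) = 0" if "u x \<noteq> 0" "z \<in> A" for x z
    proof (rule H_zero[OF u])
      have x: "norm x \<le> R" using R(2) H_zero[OF u] that by blast
      have "norm z \<ge> 1/2" using that by (auto simp: A_def)
      then have "norm (real m *\<^sub>R z) \<ge> real m * (1/2)"
        using mult_left_mono[of "1/2" "norm z" "real m"] by simp
      moreover have "norm (real m *\<^sub>R z) - norm x \<le> norm (x + real m *\<^sub>R z)"
        using norm_diff_ineq[of "real m *\<^sub>R z" x] by (simp add: add.commute)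
      ultimately show "x + real m *\<^sub>R z \<notin> \<Omega>" using R(2)[of "x + real m *\<^sub>R z"] x m by fastforce
    qed
    have "ennreal (l2 u u) * ennreal a = (\<integral>\<^sup>+ z. ennreal (l2 u u) * indicator A z \<partial>lborel)"
      using A_fin by (simp add: nn_integral_cmult a_def emeasure_eq_ennreal_measure)
    also have "\<dots> \<le> (\<integral>\<^sup>+ z. ennreal ((real m)\<^sup>2) *
        (\<integral>\<^sup>+ x. ennreal ((u x - u (x + z))\<^sup>2 * kernel_k z) \<partial>lborel) \<partial>lborel)"
    proof (rule nn_integral_mono)
      fix z
      show "ennreal (l2 u u) * indicator A z \<le> ennreal ((real m)\<^sup>2) *
        (\<integral>\<^sup>+ x. ennreal ((u x - u (x + z))\<^sup>2 * kernel_k z) \<partial>lborel)"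
      proof (cases "z \<in> A")
        case True
        have "ennreal (l2 u u) \<le> ennreal ((real m)\<^sup>2) *
            (\<integral>\<^sup>+ x. ennreal ((u x - u (x + z))\<^sup>2) \<partial>lborel)"
          unfolding sq[symmetric]
          by (rule nn_integral_square_le_increment) (use exit True in auto)
        also have "\<dots> \<le> ennreal ((real m)\<^sup>2) *
            (\<integral>\<^sup>+ x. ennreal ((u x - u (x + z))\<^sup>2 * kernel_k z) \<partial>lborel)"
          by (intro mult_left_mono nn_integral_mono ennreal_leI mult_le_cancel_left1[THEN iffD2])
             (use kA[OF True] in auto)
        finally show ?thesis using True by simp
      qed simp
    qed
    also have "\<dots> = ennreal ((real m)\<^sup>2) * (\<integral>\<^sup>+ z. 
        (\<integral>\<^sup>+ x. ennreal ((u x - u (x + z))\<^sup>2 * kernel_k z) \<partial>lborel) \<partial>lborel)"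
      by (rule nn_integral_cmult) measurable
    also have "\<dots> = ennreal ((real m)\<^sup>2) * ennreal (pair_energy u)"
      unfolding nn_integral_pair_increments[OF H_measurable[OF u], symmetric] pair_energy_def
      using H_energy[OF u] by (simp add: nn_integral_eq_integral case_prod_beta' kernel_k_nonneg)
    finally have "ennreal (l2 u u * a) \<le> ennreal ((real m)\<^sup>2 * pair_energy u)"
      using a l2.nonneg[OF u] by (simp add: ennreal_mult')
    moreover have "pair_energy u \<ge> 0" by (simp add: pair_energy_def kernel_k_nonneg)
    ultimately show ?thesis by (simp add: mult.commute)
  qed
  let ?C = "(real m)\<^sup>2 * (2 / log_lap_c CARD('n)) / a"
  have "?C > 0" using m R a log_lap_c_pos[where 'n='n] by simp
  moreover have "l2 u u \<le> ?C * energy u u" if "u \<in> H" for u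
  proof -
    have "l2 u u \<le> (real m)\<^sup>2 * pair_energy u / a"
      using main[OF that] a by (simp add: pos_le_divide_eq mult.commute)
    then show ?thesis by (simp add: pair_energy_eq mult_ac)
  qed
  ultimately show ?thesis by blast
qed

end

section \<open>Compactness of the energy space in mean square\<close>

subsection \<open>A grid of cubes\<close>

text \<open>
  Level \<open>i\<close> divides the space into half-open cubes of side \<open>1 / (N 2\<^sup>i)\<close>, indexed by integer vectors.
  The factor \<open>N\<close> makes the distance of two points of the same cube less than \<open>2\<^sup>-\<^sup>i \<le> 1\<close>, so that
  the kernel \<open>k\<close> does not vanish at their difference.
\<close>

definition mesh :: "'n::finite itself \<Rightarrow> nat \<Rightarrow> real" where
  "mesh _ i = real CARD('n) * 2 ^ i"

definition cell :: "nat \<Rightarrow> real ^ 'n \<Rightarrow> 'n \<Rightarrow> int" where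
  "cell i x = (\<lambda>j. \<lfloor>mesh TYPE('n) i * x $ j\<rfloor>)"

definition cube :: "nat \<Rightarrow> ('n \<Rightarrow> int) \<Rightarrow> (real ^ 'n) set" where
  "cube i k = {x. cell i x = k}"

lemma mesh_pos: "mesh TYPE('n::finite) i > 0"
  by (simp add: mesh_def)

lemma mem_cube_iff:
  fixes x :: "real ^ 'n"
  shows "x \<in> cube i k \<longleftrightarrow> (\<forall>j. of_int (k j) / mesh TYPE('n) i \<le> x $ j
     \<and> x $ j < (of_int (k j) + 1) / mesh TYPE('n) i)"
  using mesh_pos[where 'n='n, of i]
  by (simp add: cube_def cell_def fun_eq_iff floor_eq_iff field_simps)

lemma cube_measurable [measurable]: "cube i k \<in> sets (borel :: (real ^ 'n) measure)"
proof -
  have "cube i k = (\<Inter>j. {x :: real ^ 'n. of_int (k j) / mesh TYPE('n) i \<le> x $ j}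
      \<inter> {x. x $ j < (of_int (k j) + 1) / mesh TYPE('n) i})"
    by (auto simp: mem_cube_iff)
  also have "\<dots> \<in> sets borel" by (intro sets.finite_INT) auto
  finally show ?thesis .
qed

lemma
  fixes k :: "'n::finite \<Rightarrow> int"
  shows measure_cube: "measure lborel (cube i k) = 1 / mesh TYPE('n) i ^ CARD('n)"
    and emeasure_cube: "emeasure lborel (cube i k) < \<infinity>"
proof -
  define a :: "real ^ 'n" where "a = (\<chi> j. of_int (k j) / mesh TYPE('n) i)"
  define b :: "real ^ 'n" where "b = (\<chi> j. (of_int (k j) + 1) / mesh TYPE('n) i)"
  have le: "a \<bullet> e \<le> b \<bullet> e" if "e \<in> Basis" for e
    using that mesh_pos[where 'n='n, of i]
    by (auto simp: a_def b_def Basis_vec_def inner_axis divide_right_mono)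
  have sub: "box a b \<subseteq> cube i k" "cube i k \<subseteq> cbox a b"
    by (auto simp: mem_cube_iff mem_box_cart a_def b_def less_imp_le)
  have eq: "emeasure lborel (cube i k) = emeasure lborel (cbox a b)"
  proof (rule antisym)
    show "emeasure lborel (cube i k) \<le> emeasure lborel (cbox a b)"
      by (intro emeasure_mono sub) auto
    have "emeasure lborel (cbox a b) = emeasure lborel (box a b)"
      by (simp add: emeasure_lborel_cbox[OF le] emeasure_lborel_box[OF le])
    also have "\<dots> \<le> emeasure lborel (cube i k)"
      by (intro emeasure_mono sub) auto
    finally show "emeasure lborel (cbox a b) \<le> emeasure lborel (cube i k)" .
  qed
  have "cbox a b \<noteq> {}" using le by (simp add: box_ne_empty)
  have "measure lborel (cube i k) = measure lborel (cbox a b)"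
    using eq by (simp add: measure_def)
  also have "\<dots> = (\<Prod>j\<in>UNIV. b $ j - a $ j)"
    using \<open>cbox a b \<noteq> {}\<close> by (rule content_cbox_cart)
  also have "\<dots> = 1 / mesh TYPE('n) i ^ CARD('n)"
    by (simp add: a_def b_def diff_divide_distrib[symmetric] power_one_over)
  finally show "measure lborel (cube i k) = 1 / mesh TYPE('n) i ^ CARD('n)" .
  show "emeasure lborel (cube i k) < \<infinity>"
    unfolding eq by (rule emeasure_lborel_cbox_finite)
qed

lemma finite_cells:
  fixes S :: "(real ^ 'n) set"
  assumes "bounded S"
  shows "finite (cell i ` S)"
proof -
  obtain R where R: "\<And>x. x \<in> S \<Longrightarrow> norm x \<le> R"
    using assms by (auto simp: bounded_iff)
  define B where "B = \<lceil>mesh TYPE('n) i * R\<rceil> + 1"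
  have "cell i ` S \<subseteq> {f. \<forall>j. (j \<in> UNIV \<longrightarrow> f j \<in> {-B..B}) \<and> (j \<notin> UNIV \<longrightarrow> f j = 0)}"
  proof safe
    fix x j assume x: "x \<in> S"
    have "\<bar>x $ j\<bar> \<le> R" using component_le_norm_cart[of x j] R[OF x] by linarith
    then have "\<bar>mesh TYPE('n) i * x $ j\<bar> \<le> mesh TYPE('n) i * R"
      using mesh_pos[where 'n='n, of i] by (simp add: abs_mult)
    then show "cell i x j \<in> {-B..B}" unfolding cell_def B_def by simp linarith
  qed simp
  then show ?thesis by (rule finite_subset) (intro finite_set_of_finite_funs; simp)
qed

text \<open>Each of the \<open>N\<close> coordinates of \<open>x - y\<close> has absolute value less than \<open>1 / (N 2\<^sup>i)\<close>.\<close>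

lemma same_cell_dist:
  fixes x y :: "real ^ 'n"
  assumes "cell i x = cell i y"
  shows "2 ^ i * norm (x - y) < 1"
proof -
  let ?h = "mesh TYPE('n) i"
  have "\<bar>(x - y) $ j\<bar> < 1 / ?h" for j
  proof -
    have "\<lfloor>?h * x $ j\<rfloor> = \<lfloor>?h * y $ j\<rfloor>" using assms by (simp add: cell_def fun_eq_iff)
    then have "\<bar>?h * x $ j - ?h * y $ j\<bar> < 1" by linarith
    then have "?h * \<bar>(x - y) $ j\<bar> < 1"
      using mesh_pos[where 'n='n, of i] by (simp add: abs_mult flip: right_diff_distrib)
    then show ?thesis using mesh_pos[where 'n='n, of i] by (simp add: field_simps)
  qed
  then have "(\<Sum>j\<in>UNIV. \<bar>(x - y) $ j\<bar>) < (\<Sum>j\<in>(UNIV :: 'n set). 1 / ?h)"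
    by (intro sum_strict_mono) auto
  then have "norm (x - y) < real CARD('n) / ?h"
    using norm_le_l1_cart[of "x - y"] by simp
  also have "\<dots> = 1 / 2 ^ i" by (simp add: mesh_def)
  finally show ?thesis by (simp add: field_simps)
qed

text \<open>
  The levels that do not separate two points at distance \<open>r\<close> satisfy \<open>2\<^sup>i < 1 / r\<close>, and a
  geometric sum is comparable to its last term.
\<close>

lemma sum_powers_below:
  fixes r :: real
  assumes "r > 0" "N \<ge> 1"
  shows "(\<Sum>i<m. if 2 ^ i * r < 1 then (2 ^ i) ^ N else 0) \<le> (if r < 1 then 2 / r ^ N else 0)"
proof (induction m)
  case (Suc m)
  show ?case
  proof (cases "2 ^ m * r < 1")
    case True
    have geo: "(\<Sum>i\<le>m. ((2::real) ^ N) ^ i) \<le> 2 * (2 ^ N) ^ m"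
    proof (induction m)
      case (Suc m)
      have "(2::real) ^ 1 \<le> 2 ^ N" using assms by (intro power_increasing) auto
      then have "2 * (2 ^ N) ^ m \<le> (2::real) ^ N * (2 ^ N) ^ m"
        by (intro mult_right_mono) auto
      moreover have "(\<Sum>i\<le>Suc m. ((2::real) ^ N) ^ i) = (\<Sum>i\<le>m. (2 ^ N) ^ i) + 2 ^ N * (2 ^ N) ^ m"
        and "(2::real) * (2 ^ N) ^ Suc m = 2 * (2 ^ N * (2 ^ N) ^ m)" by simp_all
      ultimately show ?case using Suc by linarith
    qed simp
    have "(\<Sum>i<Suc m. if 2 ^ i * r < 1 then ((2::real) ^ i) ^ N else 0)
       \<le> (\<Sum>i\<le>m. (2 ^ N) ^ i)"
      unfolding lessThan_Suc_atMost by (intro sum_mono) (simp flip: power_mult add: mult.commute)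
    also have "\<dots> \<le> 2 * (2 ^ m) ^ N" using geo by (simp flip: power_mult add: mult.commute)
    also have "(2 ^ m) ^ N \<le> (1 / r) ^ N"
      using True assms by (intro power_mono) (auto simp: field_simps)
    finally have "(\<Sum>i<Suc m. if 2 ^ i * r < 1 then ((2::real) ^ i) ^ N else 0) \<le> 2 / r ^ N"
      by (simp add: power_one_over)
    moreover have "r < 1"
    proof -
      have "1 * r \<le> 2 ^ m * r" using assms by (intro mult_right_mono) auto
      then show ?thesis using True by simp
    qed
    ultimately show ?thesis by simp
  qed (use Suc in simp)
qed (use assms in simp)

lemma sum_cells_le_kernel:
  fixes x y :: "real ^ 'n"
  assumes "x \<noteq> y"
  shows "(\<Sum>i<m. if cell i x = cell i y then mesh TYPE('n) i ^ CARD('n) else 0)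
     \<le> 2 * real CARD('n) ^ CARD('n) * kernel_k (x - y)"
proof -
  let ?N = "CARD('n)" and ?r = "norm (x - y)"
  have "(\<Sum>i<m. if cell i x = cell i y then mesh TYPE('n) i ^ ?N else 0)
      \<le> (\<Sum>i<m. real ?N ^ ?N * (if 2 ^ i * ?r < 1 then (2 ^ i) ^ ?N else 0))"
    by (intro sum_mono) (auto simp: mesh_def power_mult_distrib dest: same_cell_dist)
  also have "\<dots> = real ?N ^ ?N * (\<Sum>i<m. if 2 ^ i * ?r < 1 then (2 ^ i) ^ ?N else 0)"
    by (simp add: sum_distrib_left)
  also have "\<dots> \<le> real ?N ^ ?N * (if ?r < 1 then 2 / ?r ^ ?N else 0)"
    using assms by (intro mult_left_mono sum_powers_below) (auto simp: Suc_le_eq)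
  also have "\<dots> = 2 * real ?N ^ ?N * kernel_k (x - y)"
    by (simp add: kernel_k_def)
  finally show ?thesis .
qed

subsection \<open>Oscillation on cubes is controlled by the energy\<close>

lemma (in pair_sigma_finite) integral_product_mult:
  fixes f :: "'a \<Rightarrow> real" and g :: "'b \<Rightarrow> real"
  assumes "integrable M1 f" "integrable M2 g"
  shows "(\<integral>p. f (fst p) * g (snd p) \<partial>(M1 \<Otimes>\<^sub>M M2)) = integral\<^sup>L M1 f * integral\<^sup>L M2 g"
  using integral_fst'[OF integrable_product_mult[OF assms]] by (simp add: case_prod_beta')

context bounded_domain
begin

abbreviation cube_pair :: "nat \<Rightarrow> ('n \<Rightarrow> int) \<Rightarrow> (real ^ 'n) \<times> (real ^ 'n) \<Rightarrow> real" where
  "cube_pair i k p \<equiv> indicator (cube i k) (fst p) * indicator (cube i k) (snd p)"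

text \<open>
  Expanding \<open>(w(x) - w(y))\<^sup>2\<close> over the product of a cube with itself expresses the mean square of
  \<open>w\<close> on the cube by its mean value and its oscillation.
\<close>

lemma
  assumes w: "w \<in> H"
  shows cube_pair_integrable:
      "integrable (lborel \<Otimes>\<^sub>M lborel) (\<lambda>p. cube_pair i k p * (w (fst p) - w (snd p))\<^sup>2)"
    and cube_variance:
      "(\<integral>x. indicator (cube i k) x * (w x)\<^sup>2 \<partial>lborel)
      = mesh TYPE('n) i ^ CARD('n) * (\<integral>x. indicator (cube i k) x * w x \<partial>lborel)\<^sup>2
      + (\<integral>p. mesh TYPE('n) i ^ CARD('n) * cube_pair i k p * (w (fst p) - w (snd p))\<^sup>2
          \<partial>(lborel \<Otimes>\<^sub>M lborel)) / 2"
proof -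
  let ?Q = "indicator (cube i k) :: real ^ 'n \<Rightarrow> real"
  let ?h = "mesh TYPE('n) i ^ CARD('n)"
  have i0: "integrable lborel ?Q"
    using emeasure_cube[of i k] by (intro integrable_real_indicator) auto
  have i1: "integrable lborel (\<lambda>x. ?Q x * w x)"
    using integrable_mult_indicator[OF _ H_integrable[OF w], of "cube i k"] by simp
  have i2: "integrable lborel (\<lambda>x. ?Q x * (w x)\<^sup>2)"
    using integrable_mult_indicator[OF _ H_square[OF w], of "cube i k"] by simp
  have e: "cube_pair i k p * (w (fst p) - w (snd p))\<^sup>2
     = (?Q (fst p) * (w (fst p))\<^sup>2) * ?Q (snd p) + ?Q (fst p) * (?Q (snd p) * (w (snd p))\<^sup>2)
       - 2 * ((?Q (fst p) * w (fst p)) * (?Q (snd p) * w (snd p)))" for p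
    by (simp add: power2_eq_square algebra_simps)
  have j: "integrable (lborel \<Otimes>\<^sub>M lborel) (\<lambda>p. (?Q (fst p) * (w (fst p))\<^sup>2) * ?Q (snd p))"
     "integrable (lborel \<Otimes>\<^sub>M lborel) (\<lambda>p. ?Q (fst p) * (?Q (snd p) * (w (snd p))\<^sup>2))"
     "integrable (lborel \<Otimes>\<^sub>M lborel) (\<lambda>p. (?Q (fst p) * w (fst p)) * (?Q (snd p) * w (snd p)))"
    using lborel_pair.integrable_product_mult[OF i2 i0] lborel_pair.integrable_product_mult[OF i0 i2]
      lborel_pair.integrable_product_mult[OF i1 i1]
    by (simp_all add: case_prod_beta')
  show "integrable (lborel \<Otimes>\<^sub>M lborel) (\<lambda>p. cube_pair i k p * (w (fst p) - w (snd p))\<^sup>2)"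
    unfolding e by (intro Bochner_Integration.integrable_add Bochner_Integration.integrable_diff
        integrable_mult_right j)
  have "(\<integral>p. cube_pair i k p * (w (fst p) - w (snd p))\<^sup>2 \<partial>(lborel \<Otimes>\<^sub>M lborel))
    = (\<integral>p. (?Q (fst p) * (w (fst p))\<^sup>2) * ?Q (snd p) \<partial>(lborel \<Otimes>\<^sub>M lborel))
    + (\<integral>p. ?Q (fst p) * (?Q (snd p) * (w (snd p))\<^sup>2) \<partial>(lborel \<Otimes>\<^sub>M lborel))
    - 2 * (\<integral>p. (?Q (fst p) * w (fst p)) * (?Q (snd p) * w (snd p)) \<partial>(lborel \<Otimes>\<^sub>M lborel))"
    unfolding e using j by simp
  also have "\<dots> = 2 * (1 / ?h) * (\<integral>x. ?Q x * (w x)\<^sup>2 \<partial>lborel)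
      - 2 * (\<integral>x. ?Q x * w x \<partial>lborel)\<^sup>2"
    using lborel_pair.integral_product_mult[OF i2 i0] lborel_pair.integral_product_mult[OF i0 i2]
      lborel_pair.integral_product_mult[OF i1 i1]
    by (simp add: measure_cube power2_eq_square)
  finally have "?h * (\<integral>p. cube_pair i k p * (w (fst p) - w (snd p))\<^sup>2 \<partial>(lborel \<Otimes>\<^sub>M lborel))
     = 2 * (\<integral>x. ?Q x * (w x)\<^sup>2 \<partial>lborel) - 2 * ?h * (\<integral>x. ?Q x * w x \<partial>lborel)\<^sup>2"
    using mesh_pos[where 'n='n, of i] by (simp add: right_diff_distrib)
  moreover have "(\<integral>p. ?h * cube_pair i k p * (w (fst p) - w (snd p))\<^sup>2 \<partial>(lborel \<Otimes>\<^sub>M lborel))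
     = ?h * (\<integral>p. cube_pair i k p * (w (fst p) - w (snd p))\<^sup>2 \<partial>(lborel \<Otimes>\<^sub>M lborel))"
    by (simp add: mult.assoc)
  ultimately show "(\<integral>x. ?Q x * (w x)\<^sup>2 \<partial>lborel) = ?h * (\<integral>x. ?Q x * w x \<partial>lborel)\<^sup>2
      + (\<integral>p. ?h * cube_pair i k p * (w (fst p) - w (snd p))\<^sup>2 \<partial>(lborel \<Otimes>\<^sub>M lborel)) / 2"
    by linarith
qed

lemma l2_eq_cube_sums:
  assumes w: "w \<in> H"
  shows "l2 w w = (\<Sum>k\<in>cell i ` \<Omega>. mesh TYPE('n) i ^ CARD('n)
        * (\<integral>x. indicator (cube i k) x * w x \<partial>lborel)\<^sup>2)
    + (\<integral>p. (\<Sum>k\<in>cell i ` \<Omega>. mesh TYPE('n) i ^ CARD('n) * cube_pair i k p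
        * (w (fst p) - w (snd p))\<^sup>2) \<partial>(lborel \<Otimes>\<^sub>M lborel)) / 2"
proof -
  have fin: "finite (cell i ` \<Omega>)" by (rule finite_cells[OF bounded_domain])
  have "w x * w x = (\<Sum>k\<in>cell i ` \<Omega>. indicator (cube i k) x * (w x)\<^sup>2)" for x
  proof (cases "x \<in> \<Omega>")
    case True
    have "(\<Sum>k\<in>cell i ` \<Omega>. indicator (cube i k) x * (w x)\<^sup>2)
        = (\<Sum>k\<in>cell i ` \<Omega>. if k = cell i x then (w x)\<^sup>2 else 0)"
      by (intro sum.cong) (auto simp: cube_def)
    also have "\<dots> = (w x)\<^sup>2" using fin True by simp
    finally show ?thesis by (simp add: power2_eq_square)
  qed (simp add: H_zero[OF w])
  then have "l2 w w = (\<integral>x. (\<Sum>k\<in>cell i ` \<Omega>. indicator (cube i k) x * (w x)\<^sup>2) \<partial>lborel)"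
    by (simp add: l2_def)
  also have "\<dots> = (\<Sum>k\<in>cell i ` \<Omega>. \<integral>x. indicator (cube i k) x * (w x)\<^sup>2 \<partial>lborel)"
    using integrable_mult_indicator[OF _ H_square[OF w], of "cube i _"]
    by (intro Bochner_Integration.integral_sum) simp
  also have "\<dots> = (\<Sum>k\<in>cell i ` \<Omega>. mesh TYPE('n) i ^ CARD('n)
        * (\<integral>x. indicator (cube i k) x * w x \<partial>lborel)\<^sup>2)
    + (\<Sum>k\<in>cell i ` \<Omega>. \<integral>p. mesh TYPE('n) i ^ CARD('n) * cube_pair i k p
        * (w (fst p) - w (snd p))\<^sup>2 \<partial>(lborel \<Otimes>\<^sub>M lborel)) / 2"
    unfolding cube_variance[OF w] by (simp add: sum.distrib sum_divide_distrib)
  also have "(\<Sum>k\<in>cell i ` \<Omega>. \<integral>p. mesh TYPE('n) i ^ CARD('n) * cube_pair i k p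
        * (w (fst p) - w (snd p))\<^sup>2 \<partial>(lborel \<Otimes>\<^sub>M lborel)) =
     (\<integral>p. (\<Sum>k\<in>cell i ` \<Omega>. mesh TYPE('n) i ^ CARD('n) * cube_pair i k p
        * (w (fst p) - w (snd p))\<^sup>2) \<partial>(lborel \<Otimes>\<^sub>M lborel))"
    using cube_pair_integrable[OF w]
    by (intro Bochner_Integration.integral_sum[symmetric]) (simp add: mult.assoc)
  finally show ?thesis .
qed

text \<open>
  The identity for each of the first \<open>m\<close> levels is added up.  The oscillations on all levels
  together are bounded by one multiple of the energy, so their average is \<open>O(1/m)\<close>.
\<close>

lemma l2_le_cube_averages:
  assumes w: "w \<in> H"
  shows "real m * l2 w w \<le> (\<Sum>i<m. \<Sum>k\<in>cell i ` \<Omega>. mesh TYPE('n) i ^ CARD('n)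
        * (\<integral>x. indicator (cube i k) x * w x \<partial>lborel)\<^sup>2)
     + real CARD('n) ^ CARD('n) * pair_energy w"
proof -
  let ?h = "\<lambda>i. mesh TYPE('n) i ^ CARD('n)" and ?N = "CARD('n)"
  let ?F = "\<lambda>i p. \<Sum>k\<in>cell i ` \<Omega>. ?h i * cube_pair i k p * (w (fst p) - w (snd p))\<^sup>2"
  have F_int: "integrable (lborel \<Otimes>\<^sub>M lborel) (?F i)" for i
    using cube_pair_integrable[OF w]
    by (intro Bochner_Integration.integrable_sum) (simp add: mult.assoc)
  have same: "(\<Sum>k\<in>cell i ` \<Omega>. cube_pair i k p)
      \<le> (if cell i (fst p) = cell i (snd p) then 1 else 0)" for i p
  proof -
    have "(\<Sum>k\<in>cell i ` \<Omega>. cube_pair i k p) \<le> (\<Sum>k\<in>cell i ` \<Omega>.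
        if k = cell i (fst p) then (if cell i (fst p) = cell i (snd p) then 1 else 0) else 0)"
      by (intro sum_mono) (auto simp: cube_def indicator_def)
    also have "\<dots> \<le> (if cell i (fst p) = cell i (snd p) then 1 else 0)"
      using finite_cells[OF bounded_domain, of i] by simp
    finally show ?thesis .
  qed
  have F_le: "(\<Sum>i<m. ?F i p) \<le> 2 * real ?N ^ ?N
      * ((w (fst p) - w (snd p))\<^sup>2 * kernel_k (fst p - snd p))" for p
  proof (cases "fst p = snd p")
    case False
    have "(\<Sum>i<m. ?F i p) = (w (fst p) - w (snd p))\<^sup>2 *
        (\<Sum>i<m. ?h i * (\<Sum>k\<in>cell i ` \<Omega>. cube_pair i k p))"
      by (simp add: sum_distrib_left sum_distrib_right mult_ac)
    also have "\<dots> \<le> (w (fst p) - w (snd p))\<^sup>2 *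
        (\<Sum>i<m. ?h i * (if cell i (fst p) = cell i (snd p) then 1 else 0))"
      using mesh_pos[where 'n='n]
      by (intro mult_left_mono sum_mono same) (auto intro: less_imp_le)
    also have "\<dots> = (w (fst p) - w (snd p))\<^sup>2 *
        (\<Sum>i<m. if cell i (fst p) = cell i (snd p) then ?h i else 0)"
      by (intro arg_cong[where f="\<lambda>t. _ * t"] sum.cong) auto
    also have "\<dots> \<le> (w (fst p) - w (snd p))\<^sup>2 *
        (2 * real ?N ^ ?N * kernel_k (fst p - snd p))"
      by (intro mult_left_mono sum_cells_le_kernel False) auto
    finally show ?thesis by (simp add: mult_ac)
  qed (simp add: kernel_k_nonneg)
  have "(\<Sum>i<m. \<integral>p. ?F i p \<partial>(lborel \<Otimes>\<^sub>M lborel)) = (\<integral>p. (\<Sum>i<m. ?F i p) \<partial>(lborel \<Otimes>\<^sub>M lborel))"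
    by (intro Bochner_Integration.integral_sum[symmetric] F_int)
  also have "\<dots> \<le> (\<integral>p. 2 * real ?N ^ ?N
      * ((w (fst p) - w (snd p))\<^sup>2 * kernel_k (fst p - snd p)) \<partial>(lborel \<Otimes>\<^sub>M lborel))"
    using H_energy[OF w]
    by (intro integral_mono F_le Bochner_Integration.integrable_sum F_int integrable_mult_right)
      (simp add: case_prod_beta')
  also have "\<dots> = 2 * real ?N ^ ?N * pair_energy w"
    by (simp add: pair_energy_def)
  finally have *: "(\<Sum>i<m. \<integral>p. ?F i p \<partial>(lborel \<Otimes>\<^sub>M lborel)) \<le> 2 * real ?N ^ ?N * pair_energy w" .
  have "real m * l2 w w = (\<Sum>i<m. l2 w w)" by simp
  also have "\<dots> = (\<Sum>i<m. (\<Sum>k\<in>cell i ` \<Omega>. ?h i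
        * (\<integral>x. indicator (cube i k) x * w x \<partial>lborel)\<^sup>2)
      + (\<integral>p. ?F i p \<partial>(lborel \<Otimes>\<^sub>M lborel)) / 2)"
    by (rule sum.cong[OF refl]) (rule l2_eq_cube_sums[OF w])
  also have "\<dots> = (\<Sum>i<m. \<Sum>k\<in>cell i ` \<Omega>. ?h i
        * (\<integral>x. indicator (cube i k) x * w x \<partial>lborel)\<^sup>2)
      + (\<Sum>i<m. \<integral>p. ?F i p \<partial>(lborel \<Otimes>\<^sub>M lborel)) / 2"
    by (simp add: sum.distrib sum_divide_distrib)
  finally show ?thesis using * by linarith
qed

end

subsection \<open>Extraction of convergent subsequences\<close>

text \<open>
  A sequence of points of a cube with countably many coordinates lies in a compact metrizable space.
\<close>

lemma bounded_coordinates_subsequence: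
  fixes a :: "nat \<Rightarrow> 'i::countable \<Rightarrow> real"
  assumes "\<And>n i. \<bar>a n i\<bar> \<le> B"
  obtains q :: "nat \<Rightarrow> nat" and l where "strict_mono q" "\<And>i. (\<lambda>n. a (q n) i) \<longlonglongrightarrow> l i"
proof -
  let ?S = "PiE UNIV (\<lambda>_::'i. {-B..B})"
  have "compactin (product_topology (\<lambda>_. euclidean) UNIV) ?S"
    by (simp add: compactin_PiE)
  then have "compact ?S"
    unfolding euclidean_product_topology compactin_euclidean_iff .
  then have "seq_compact ?S" by (rule compact_imp_seq_compact)
  moreover have "\<forall>n. a n \<in> ?S" using assms by (auto simp: abs_le_iff minus_le_iff)
  ultimately obtain l q where q: "strict_mono q" and lim: "(a \<circ> q) \<longlonglongrightarrow> l"
    unfolding seq_compact_def by metis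
  have "(\<lambda>n. a (q n) i) \<longlonglongrightarrow> l i" for i
    using continuous_on_tendsto_compose[OF continuous_on_product_coordinates lim, of i] by simp
  then show thesis by (rule that[OF q])
qed

context bounded_domain
begin

lemma cube_integral_bound:
  assumes "u \<in> H"
  shows "\<bar>\<integral>x. indicator (cube i k) x * u x \<partial>lborel\<bar> \<le> measure lborel \<Omega> + l2 u u"
proof -
  have "\<bar>\<integral>x. indicator (cube i k) x * u x \<partial>lborel\<bar>
      \<le> (\<integral>x. \<bar>indicator (cube i k) x * u x\<bar> \<partial>lborel)" by (rule integral_abs_bound)
  also have "\<dots> \<le> (\<integral>x. indicator \<Omega> x + (u x)\<^sup>2 \<partial>lborel)"
  proof (rule integral_mono)
    show "integrable lborel (\<lambda>x. \<bar>indicator (cube i k) x * u x\<bar>)"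
      using integrable_mult_indicator[OF _ H_integrable[OF assms], of "cube i k"] by simp
    show "integrable lborel (\<lambda>x. indicator \<Omega> x + (u x)\<^sup>2)"
      using integrable_indicator_domain H_square[OF assms] by simp
    show "\<bar>indicator (cube i k) x * u x\<bar> \<le> indicator \<Omega> x + (u x)\<^sup>2" for x
      using H_abs_bound[OF assms, of x] by (cases "x \<in> cube i k"; cases "x \<in> \<Omega>") auto
  qed
  also have "\<dots> = measure lborel \<Omega> + l2 u u"
    using integrable_indicator_domain H_square[OF assms]
    by (simp add: l2_def power2_eq_square)
  finally show ?thesis .
qed

text \<open>
  Along a subsequence the integrals over all cubes of all levels converge.  For differences of two
  members, the sum over the finitely many cubes of the first \<open>m\<close> levels therefore tends to 0, and the
  oscillation term is \<open>O(1/m)\<close>: the subsequence is Cauchy in mean square.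
\<close>

theorem compact_embedding:
  assumes f: "\<And>n. f n \<in> H" and bound: "\<And>n. energy (f n) (f n) \<le> M" "\<And>n. l2 (f n) (f n) \<le> M"
  obtains r :: "nat \<Rightarrow> nat" and u where "strict_mono r" "u \<in> H"
    "AE x in lborel. (\<lambda>n. f (r n) x) \<longlonglongrightarrow> u x"
    "(\<lambda>n. l2 (\<lambda>x. f (r n) x - u x) (\<lambda>x. f (r n) x - u x)) \<longlonglongrightarrow> 0"
proof -
  define a where "a n = (\<lambda>(i, k). \<integral>x. indicator (cube i k) x * f n x \<partial>lborel)" for n
  have "\<bar>a n p\<bar> \<le> measure lborel \<Omega> + M" for n p
    using cube_integral_bound[OF f[of n], of "fst p" "snd p"] bound(2)[of n]
    by (simp add: a_def case_prod_beta')
  then obtain q l where q: "strict_mono q" and lim: "\<And>p. (\<lambda>n. a (q n) p) \<longlonglongrightarrow> l p"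
    using bounded_coordinates_subsequence[of a] by metis
  let ?h = "\<lambda>i. mesh TYPE('n) i ^ CARD('n)" and ?c = "log_lap_c CARD('n)"
  define D where "D = real CARD('n) ^ CARD('n) * (8 * M / ?c)"
  \<comment> \<open>By the parallelogram law.\<close>
  have energy_diff: "energy (\<lambda>x. u x - v x) (\<lambda>x. u x - v x) \<le> 4 * M"
    if "u \<in> H" "v \<in> H" "energy u u \<le> M" "energy v v \<le> M" for u v
    using energy.expand[OF that(1,2), of 1 1] energy.expand_diff[OF that(1,2)]
      energy.nonneg[OF H_lin_closed[OF that(1,2), of 1 1]] that(3,4) by simp
  have Cauchy: "\<exists>N. \<forall>m\<ge>N. \<forall>n\<ge>N.
      l2 (\<lambda>x. f (q m) x - f (q n) x) (\<lambda>x. f (q m) x - f (q n) x) \<le> e" if "e > 0" for e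
  proof -
    obtain m :: nat where m: "real m > 2 * D / e" using reals_Archimedean2 by blast
    have "M \<ge> 0" using l2.nonneg[OF f[of 0]] bound(2)[of 0] by linarith
    then have "D \<ge> 0" using log_lap_c_pos[where 'n='n] by (simp add: D_def)
    then have m0: "real m > 0" using m \<open>e > 0\<close>
      by (smt (verit) divide_nonneg_pos)
    have D_small: "D \<le> real m * (e / 2)" using m \<open>e > 0\<close> by (simp add: pos_divide_less_eq)
    define T where "T n = (\<Sum>i<m. \<Sum>k\<in>cell i ` \<Omega>. ?h i * (a (q n) (i, k) - l (i, k))\<^sup>2)" for n
    have "T \<longlonglongrightarrow> (\<Sum>i<m. \<Sum>k\<in>cell i ` \<Omega>. ?h i * (l (i, k) - l (i, k))\<^sup>2)"
      unfolding T_def[abs_def] by (intro tendsto_intros lim)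
    then have "T \<longlonglongrightarrow> 0" by simp
    then have "\<forall>\<^sub>F n in sequentially. T n < real m * e / 8"
      by (rule order_tendstoD(2)) (use m0 \<open>e > 0\<close> in simp)
    then obtain N where N: "\<And>n. n \<ge> N \<Longrightarrow> T n < real m * e / 8"
      by (auto simp: eventually_sequentially)
    have "l2 (\<lambda>x. f (q n1) x - f (q n2) x) (\<lambda>x. f (q n1) x - f (q n2) x) \<le> e"
      if n: "n1 \<ge> N" "n2 \<ge> N" for n1 n2
    proof -
      let ?w = "\<lambda>x. f (q n1) x - f (q n2) x"
      have w: "?w \<in> H" by (intro l2.diff_closed f)
      have avg: "(\<integral>x. indicator (cube i k) x * ?w x \<partial>lborel) = a (q n1) (i, k) - a (q n2) (i, k)"
        for i k
        using integrable_mult_indicator[OF _ H_integrable[OF f[of "q n1"]], of "cube i k"]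
          integrable_mult_indicator[OF _ H_integrable[OF f[of "q n2"]], of "cube i k"]
        by (simp add: a_def right_diff_distrib)
      have sq: "(s - t)\<^sup>2 \<le> 2 * (s - z)\<^sup>2 + 2 * (t - z)\<^sup>2" for s t z :: real
        using zero_le_power2[of "(s - z) + (t - z)"] by (simp add: power2_eq_square algebra_simps)
      have "(\<Sum>i<m. \<Sum>k\<in>cell i ` \<Omega>. ?h i * (a (q n1) (i, k) - a (q n2) (i, k))\<^sup>2)
          \<le> (\<Sum>i<m. \<Sum>k\<in>cell i ` \<Omega>. ?h i * (2 * (a (q n1) (i, k) - l (i, k))\<^sup>2
               + 2 * (a (q n2) (i, k) - l (i, k))\<^sup>2))"
        using mesh_pos[where 'n='n]
        by (intro sum_mono mult_left_mono sq) (auto intro: less_imp_le)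
      also have "\<dots> = 2 * T n1 + 2 * T n2"
        by (simp add: T_def sum.distrib sum_distrib_left distrib_left mult_ac)
      also have "\<dots> \<le> real m * (e / 2)" using N[OF n(1)] N[OF n(2)] by simp
      finally have 1: "(\<Sum>i<m. \<Sum>k\<in>cell i ` \<Omega>.
          ?h i * (a (q n1) (i, k) - a (q n2) (i, k))\<^sup>2) \<le> real m * (e / 2)" .
      have "pair_energy ?w \<le> 2 / ?c * (4 * M)"
        unfolding pair_energy_eq using log_lap_c_pos[where 'n='n]
        by (intro mult_left_mono energy_diff f bound) auto
      then have "real CARD('n) ^ CARD('n) * pair_energy ?w \<le> real CARD('n) ^ CARD('n) * (2 / ?c * (4 * M))"
        by (intro mult_left_mono) auto
      also have "\<dots> = D" by (simp add: D_def)
      finally have "real m * l2 ?w ?w \<le> real m * e"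
        using l2_le_cube_averages[OF w, of m] 1 D_small unfolding avg by simp
      then show ?thesis using m0 by simp
    qed
    then show ?thesis by blast
  qed
  obtain r u where "strict_mono r" "u \<in> H"
    "AE x in lborel. (\<lambda>n. f (q (r n)) x) \<longlonglongrightarrow> u x"
    "(\<lambda>n. l2 (\<lambda>x. f (q (r n)) x - u x) (\<lambda>x. f (q (r n)) x - u x)) \<longlonglongrightarrow> 0"
    by (rule L2_Cauchy_limit[of "\<lambda>n. f (q n)" M, OF f bound Cauchy]) (assumption, rule that)
  then show thesis by (intro that[of "q \<circ> r" u]) (simp_all add: strict_mono_o q)
qed

end

section \<open>Bump functions\<close>

text \<open>
  Lipschitz functions of bounded support have finite energy because \<open>|z|\<^sup>2 k(z)\<close> is integrable: on the dyadic shell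
  \<open>2\<^sup>-\<^sup>n\<^sup>-\<^sup>1 \<le> |z| < 2\<^sup>-\<^sup>n\<close> it is at most \<open>4\<^sup>-\<^sup>n 2\<^sup>(\<^sup>n\<^sup>+\<^sup>1\<^sup>)\<^sup>N\<close>, while the shell has volume \<open>O(2\<^sup>-\<^sup>n\<^sup>N)\<close>.
\<close>

lemma kernel_second_moment_finite:
  "(\<integral>\<^sup>+ z. ennreal ((norm z)\<^sup>2 * kernel_k z) \<partial>(lborel :: (real ^ 'n) measure)) < \<infinity>"
proof -
  let ?N = "CARD('n)" and ?V = "unit_ball_vol (real CARD('n))"
  define t :: "nat \<Rightarrow> real" where "t n = (1/4) ^ n * (2 ^ Suc n) ^ ?N" for n
  have t_pos: "t n \<ge> 0" for n by (simp add: t_def)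
  have le: "ennreal ((norm z)\<^sup>2 * kernel_k z)
      \<le> (\<Sum>n. ennreal (t n) * indicator (ball 0 ((1/2) ^ n)) z)" for z :: "real ^ 'n"
  proof (cases "z = 0 \<or> norm z \<ge> 1")
    case False
    then have z: "norm z > 0" "norm z < 1" by auto
    have ex: "\<exists>m. (1/2) ^ m \<le> norm z"
      using real_arch_pow_inv[OF z(1), of "1/2"] by (auto intro: less_imp_le)
    define m where "m = (LEAST m. (1/2) ^ m \<le> norm z)"
    have m: "(1/2) ^ m \<le> norm z" unfolding m_def by (rule LeastI_ex[OF ex])
    have "m \<noteq> 0"
    proof
      assume "m = 0"
      with m z show False by simp
    qed
    then obtain n where n: "m = Suc n" using not0_implies_Suc by blast
    have small: "norm z < (1/2) ^ n"
      using not_less_Least[of n "\<lambda>m. (1/2) ^ m \<le> norm z"] n by (simp add: m_def)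
    have "((1/2) ^ Suc n) ^ ?N \<le> norm z ^ ?N" using m n by (intro power_mono) auto
    then have "(norm z)\<^sup>2 / norm z ^ ?N \<le> ((1/2) ^ n)\<^sup>2 / ((1/2) ^ Suc n) ^ ?N"
      using small by (intro frac_le power_mono) auto
    also have "\<dots> = t n"
    proof -
      have "((1/2) ^ n)\<^sup>2 = (1/4 :: real) ^ n"
        by (simp add: power2_eq_square flip: power_mult_distrib)
      then show ?thesis by (simp add: t_def power_one_over)
    qed
    finally have "ennreal ((norm z)\<^sup>2 * kernel_k z) \<le> ennreal (t n)"
      using z by (intro ennreal_leI) (simp add: kernel_k_def)
    also have "\<dots> = (\<Sum>n\<in>{n}. ennreal (t n) * indicator (ball 0 ((1/2) ^ n)) z)"
      using small by simp
    also have "\<dots> \<le> (\<Sum>n. ennreal (t n) * indicator (ball 0 ((1/2) ^ n)) z)"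
      by (intro sum_le_suminf) auto
    finally show ?thesis .
  qed (auto simp: kernel_k_def)
  have shell: "(\<integral>\<^sup>+ z. ennreal (t n) * indicator (ball 0 ((1/2) ^ n)) z
        \<partial>(lborel :: (real ^ 'n) measure)) = ennreal (2 ^ ?N * ?V * (1/4) ^ n)" for n
  proof -
    have "(\<integral>\<^sup>+ z. ennreal (t n) * indicator (ball 0 ((1/2) ^ n)) z
        \<partial>(lborel :: (real ^ 'n) measure)) = ennreal (t n) * ennreal (?V * ((1/2) ^ n) ^ ?N)"
      by (subst nn_integral_cmult_indicator) (simp_all add: emeasure_ball)
    also have "\<dots> = ennreal (t n * (?V * ((1/2) ^ n) ^ ?N))"
      using t_pos by (simp add: ennreal_mult')
    also have "t n * (?V * ((1/2) ^ n) ^ ?N) = (1/4) ^ n * ?V * (2 ^ Suc n * (1/2) ^ n) ^ ?N"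
      by (simp only: t_def power_mult_distrib mult_ac)
    also have "(2::real) ^ Suc n * (1/2) ^ n = 2" by (simp add: power_one_over)
    finally show ?thesis by (simp add: mult_ac)
  qed
  have "(\<integral>\<^sup>+ z. ennreal ((norm z)\<^sup>2 * kernel_k z) \<partial>(lborel :: (real ^ 'n) measure))
    \<le> (\<integral>\<^sup>+ z. (\<Sum>n. ennreal (t n) * indicator (ball 0 ((1/2) ^ n)) z)
        \<partial>(lborel :: (real ^ 'n) measure))"
    by (intro nn_integral_mono le)
  also have "\<dots> = (\<Sum>n. ennreal (2 ^ ?N * ?V * (1/4) ^ n))"
    unfolding shell[symmetric]
    by (rule nn_integral_suminf) (auto intro!: borel_measurable_times_ennreal borel_measurable_indicator)
  also have "\<dots> < \<infinity>"
  proof -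
    have "summable (\<lambda>n. 2 ^ ?N * ?V * (1/4) ^ n)"
      by (intro summable_mult summable_geometric) simp
    then have "(\<Sum>n. ennreal (2 ^ ?N * ?V * (1/4) ^ n)) \<noteq> top"
      by (rule ennreal_suminf_neq_top) simp
    then show ?thesis by (simp add: less_top)
  qed
  finally show ?thesis .
qed

lemma exists_annihilating_pair:
  fixes s t :: real
  obtains a b where "a \<noteq> 0 \<or> b \<noteq> 0" "a * s + b * t = 0"
proof (cases "s = 0")
  case True
  then show thesis using that[of 1 0] by simp
next
  case False
  then show thesis using that[of "- t" s] by simp
qed

definition bump :: "'a::metric_space \<Rightarrow> real \<Rightarrow> 'a \<Rightarrow> real" where
  "bump p r x = max 0 (r - dist x p)"

lemma bump_Lipschitz: "\<bar>bump p r x - bump p r y\<bar> \<le> dist x y"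
proof -
  have "\<bar>dist x p - dist y p\<bar> \<le> dist x y" 
    using dist_triangle[of x p y] dist_triangle[of y p x] by (simp add: dist_commute abs_le_iff)
  then show ?thesis unfolding bump_def by linarith
qed

context bounded_domain
begin

text \<open>
  The increment of a bump is at most \<open>|z|\<close>, and it vanishes unless \<open>x\<close> or \<open>x + z\<close> lies in \<open>\<Omega>\<close>.
\<close>

lemma bump_in_H:
  assumes "ball p r \<subseteq> \<Omega>"
  shows "bump p r \<in> H"
proof -
  let ?v = "bump p r"
  have "continuous_on UNIV ?v" unfolding bump_def[abs_def] by (intro continuous_intros)
  then have [measurable]: "?v \<in> borel_measurable borel"
    by (rule borel_measurable_continuous_onI)
  have zero: "?v x = 0" if "x \<notin> \<Omega>" for x
    using that assms by (force simp: bump_def dist_commute)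
  have sq: "integrable lborel (\<lambda>x. (?v x)\<^sup>2)"
  proof (rule integrableI_bounded_set[where A=\<Omega> and B="r\<^sup>2"])
    have "(?v x)\<^sup>2 \<le> r\<^sup>2" for x
      using zero_le_dist[of x p] by (auto simp: bump_def max_def intro!: power_mono)
    then show "AE x in lborel. x \<in> \<Omega> \<longrightarrow> norm ((?v x)\<^sup>2) \<le> r\<^sup>2" by simp
  qed (use emeasure_domain zero in auto)
  have "(\<integral>\<^sup>+ q. ennreal ((?v (fst q) - ?v (snd q))\<^sup>2 * kernel_k (fst q - snd q))
      \<partial>(lborel \<Otimes>\<^sub>M lborel))
    = (\<integral>\<^sup>+ z. \<integral>\<^sup>+ x. ennreal ((?v x - ?v (x + z))\<^sup>2 * kernel_k z) \<partial>lborel \<partial>lborel)"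
    by (rule nn_integral_pair_increments) measurable
  also have "\<dots> \<le> (\<integral>\<^sup>+ z. ennreal ((norm z)\<^sup>2 * kernel_k z) * (2 * emeasure lborel \<Omega>)
      \<partial>(lborel :: (real ^ 'n) measure))"
  proof (rule nn_integral_mono)
    fix z :: "real ^ 'n"
    have le: "(?v x - ?v (x + z))\<^sup>2 * kernel_k z
        \<le> ((norm z)\<^sup>2 * kernel_k z) * (indicator \<Omega> x + indicator \<Omega> (z + x))" for x
    proof -
      have "\<bar>?v x - ?v (x + z)\<bar>\<^sup>2 \<le> (norm z)\<^sup>2"
        using bump_Lipschitz[of p r x "x + z"] by (intro power_mono) (auto simp: dist_norm)
      moreover have "(?v x - ?v (x + z))\<^sup>2 = 0" if "x \<notin> \<Omega>" "z + x \<notin> \<Omega>"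
        using zero that by (simp add: add.commute)
      moreover have "(norm z)\<^sup>2 * 1 \<le> (norm z)\<^sup>2 * (indicator \<Omega> x + indicator \<Omega> (z + x))"
        if "x \<in> \<Omega> \<or> z + x \<in> \<Omega>"
        using that by (intro mult_left_mono) auto
      ultimately have "(?v x - ?v (x + z))\<^sup>2 \<le> (norm z)\<^sup>2 * (indicator \<Omega> x + indicator \<Omega> (z + x))"
        by (cases "x \<in> \<Omega> \<or> z + x \<in> \<Omega>") auto
      from mult_left_mono[OF this kernel_k_nonneg[of z]] show ?thesis by (simp add: mult_ac)
    qed
    have "ennreal ((?v x - ?v (x + z))\<^sup>2 * kernel_k z)
        \<le> ennreal ((norm z)\<^sup>2 * kernel_k z) * (indicator \<Omega> x + indicator \<Omega> (z + x))" for x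
    proof -
      have "ennreal ((?v x - ?v (x + z))\<^sup>2 * kernel_k z)
          \<le> ennreal (((norm z)\<^sup>2 * kernel_k z) * (indicator \<Omega> x + indicator \<Omega> (z + x)))"
        by (rule ennreal_leI) (rule le)
      also have "\<dots> = ennreal ((norm z)\<^sup>2 * kernel_k z) * (indicator \<Omega> x + indicator \<Omega> (z + x))"
        by (cases "x \<in> \<Omega>"; cases "z + x \<in> \<Omega>") (simp_all add: ennreal_mult'')
      finally show ?thesis .
    qed
    then have "(\<integral>\<^sup>+ x. ennreal ((?v x - ?v (x + z))\<^sup>2 * kernel_k z) \<partial>lborel)
       \<le> (\<integral>\<^sup>+ x. ennreal ((norm z)\<^sup>2 * kernel_k z) *
            (indicator \<Omega> x + indicator \<Omega> (z + x)) \<partial>lborel)"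
      by (rule nn_integral_mono)
    also have "\<dots> = ennreal ((norm z)\<^sup>2 * kernel_k z) *
        ((\<integral>\<^sup>+ x. indicator \<Omega> x \<partial>lborel) + (\<integral>\<^sup>+ x. indicator \<Omega> (z + x) \<partial>lborel))"
      by (subst nn_integral_cmult, measurable, subst nn_integral_add, measurable)
    also have "(\<integral>\<^sup>+ x. indicator \<Omega> (z + x) \<partial>lborel) = (\<integral>\<^sup>+ x. indicator \<Omega> x \<partial>lborel)"
      by (rule nn_integral_lborel_translate) measurable
    finally show "(\<integral>\<^sup>+ x. ennreal ((?v x - ?v (x + z))\<^sup>2 * kernel_k z) \<partial>lborel)
       \<le> ennreal ((norm z)\<^sup>2 * kernel_k z) * (2 * emeasure lborel \<Omega>)"
      by (simp add: mult_2)
  qed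
  also have "\<dots> = (\<integral>\<^sup>+ z. ennreal ((norm z)\<^sup>2 * kernel_k z) \<partial>(lborel :: (real ^ 'n) measure))
      * (2 * emeasure lborel \<Omega>)"
    by (rule nn_integral_multc) measurable
  also have "\<dots> < \<infinity>"
    using kernel_second_moment_finite[where 'n='n] emeasure_domain
    by (simp add: ennreal_mult_less_top ennreal_mult_eq_top_iff less_top)
  finally have "integrable (lborel \<Otimes>\<^sub>M lborel)
      (\<lambda>q. (?v (fst q) - ?v (snd q))\<^sup>2 * kernel_k (fst q - snd q))"
    by (intro integrableI_nonneg) (auto simp: kernel_k_nonneg)
  then show ?thesis
    using sq zero by (simp add: H_space_def case_prod_beta')
qed

lemma bump_l2_pos:
  assumes "ball p r \<subseteq> \<Omega>" "r > 0"
  shows "l2 (bump p r) (bump p r) > 0"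
proof -
  have "l2 (bump p r) (bump p r) \<noteq> 0"
  proof
    assume "l2 (bump p r) (bump p r) = 0"
    then have "AE x in lborel. bump p r x = 0"
      using null_iff_l2[OF bump_in_H[OF assms(1)]] by simp
    then have "AE x in lborel. x \<notin> ball p r"
      by eventually_elim (auto simp: bump_def dist_commute)
    then have "emeasure lborel (ball p r) = 0"
      by (subst (asm) AE_iff_measurable[of "ball p r"]) auto
    moreover have "0 < measure lborel (ball p r)" by (rule content_ball_pos[OF assms(2)])
    ultimately show False by (simp add: measure_def)
  qed
  then show ?thesis using l2.nonneg[OF bump_in_H[OF assms(1)]] by simp
qed

text \<open>Two bumps with disjoint supports span a plane, which meets any hyperplane.\<close>

lemma exists_orthogonal:
  assumes "\<Omega> \<noteq> {}" "\<phi> \<in> H"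
  obtains w where "w \<in> H" "l2 w \<phi> = 0" "l2 w w > 0"
proof -
  obtain p e where e: "e > 0" "ball p e \<subseteq> \<Omega>"
    using assms(1) open_domain by (meson ex_in_conv open_contains_ball)
  define q where "q = p + (e / 2) *\<^sub>R axis undefined 1"
  have pq: "dist p q = e / 2" using e by (simp add: q_def dist_norm)
  let ?u = "bump p (e / 4)" and ?v = "bump q (e / 4)"
  have sub: "ball p (e / 4) \<subseteq> \<Omega>" "ball q (e / 4) \<subseteq> \<Omega>"
  proof -
    show "ball p (e / 4) \<subseteq> \<Omega>" using e by (intro order_trans[OF subset_ball e(2)]) simp
    show "ball q (e / 4) \<subseteq> \<Omega>"
    proof
      fix x assume "x \<in> ball q (e / 4)"
      then have "dist p x < e" using dist_triangle[of p x q] pq e(1) by simp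
      then show "x \<in> \<Omega>" using e(2) by auto
    qed
  qed
  note H = bump_in_H[OF sub(1)] bump_in_H[OF sub(2)]
  have "?u x * ?v x = 0" for x
  proof -
    have "e / 2 \<le> dist x p + dist x q"
      using dist_triangle[of p q x] pq by (simp add: dist_commute)
    then have "dist x p \<ge> e / 4 \<or> dist x q \<ge> e / 4" by linarith
    then show ?thesis by (auto simp: bump_def)
  qed
  then have orth: "l2 ?u ?v = 0" unfolding l2_def by (simp only: integral_zero)
  obtain a b where ab: "a \<noteq> 0 \<or> b \<noteq> 0" "a * l2 ?u \<phi> + b * l2 ?v \<phi> = 0"
    by (rule exists_annihilating_pair)
  show thesis
  proof
    show "(\<lambda>x. a * ?u x + b * ?v x) \<in> H" by (rule H_lin_closed[OF H])
    show "l2 (\<lambda>x. a * ?u x + b * ?v x) \<phi> = 0" using ab(2) l2.lin[OF H assms(2)] by simp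
    have "l2 ?u ?u > 0" "l2 ?v ?v > 0" using bump_l2_pos sub e(1) by auto
    then have "a\<^sup>2 * l2 ?u ?u + b\<^sup>2 * l2 ?v ?v > 0"
      using ab(1) by (auto intro: add_pos_nonneg add_nonneg_pos)
    then show "l2 (\<lambda>x. a * ?u x + b * ?v x) (\<lambda>x. a * ?u x + b * ?v x) > 0"
      using l2.expand[OF H, of a b] orth by simp
  qed
qed

end

section \<open>The first two eigenvalues\<close>

context bounded_domain
begin

text \<open>
  After adding a multiple of the mean-square form, the lower order part of \<open>E\<^sub>L\<close> and \<open>E\<^sub>L\<close> itself
  become nonnegative, and are continuous for mean-square and energy convergence respectively.
\<close>

lemma shifted_forms:
  obtains M where "M > 0" "\<And>u. u \<in> H \<Longrightarrow> \<bar>low_form u u\<bar> \<le> M * l2 u u"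
    "nonneg_form H (\<lambda>u v. low_form u v + M * l2 u v)"
    "nonneg_form H (\<lambda>u v. energy_L u v + M * l2 u v)"
proof -
  obtain M where M: "M > 0" "\<And>u. u \<in> H \<Longrightarrow> \<bar>low_form u u\<bar> \<le> M * l2 u u"
    using low_form_bound by blast
  have 0: "0 \<le> low_form u u + M * l2 u u" if "u \<in> H" for u
    using M(2)[OF that] by linarith
  have 1: "nonneg_form H (\<lambda>u v. low_form u v + M * l2 u v)"
    using symmetric_form_combine[OF low.symmetric_form_axioms l2.symmetric_form_axioms, of 1 M] 0
    by (simp add: nonneg_form_def nonneg_form_axioms_def)
  have "0 \<le> energy_L u u + M * l2 u u" if "u \<in> H" for u
    using 0[OF that] energy.nonneg[OF that] unfolding energy_L_decompose by linarith
  then have 2: "nonneg_form H (\<lambda>u v. energy_L u v + M * l2 u v)"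
    using symmetric_form_combine[OF energy_L.symmetric_form_axioms l2.symmetric_form_axioms, of 1 M]
    by (simp add: nonneg_form_def nonneg_form_axioms_def)
  show thesis by (rule that[OF M 1 2])
qed

text \<open>
  The Poincare inequality makes energy convergence control mean-square convergence, and with it
  all terms of \<open>E\<^sub>L\<close>.
\<close>

lemma energy_L_tendsto_of_energy:
  assumes ev: "\<forall>\<^sub>F s in F. f s \<in> H" and u: "u \<in> H"
    and lim: "((\<lambda>s. energy (\<lambda>x. f s x - u x) (\<lambda>x. f s x - u x)) \<longlongrightarrow> 0) F"
  shows "((\<lambda>s. energy_L (f s) (f s)) \<longlongrightarrow> energy_L u u) F"
    and "w \<in> H \<Longrightarrow> ((\<lambda>s. l2 (f s) w) \<longlongrightarrow> l2 u w) F"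
proof -
  obtain C where C: "C > 0" "\<And>u. u \<in> H \<Longrightarrow> l2 u u \<le> C * energy u u"
    using Poincare by blast
  obtain M where M: "M > 0" "\<And>u. u \<in> H \<Longrightarrow> \<bar>low_form u u\<bar> \<le> M * l2 u u"
    and "nonneg_form H (\<lambda>u v. low_form u v + M * l2 u v)"
    and pos: "nonneg_form H (\<lambda>u v. energy_L u v + M * l2 u v)"
    by (rule shifted_forms) (rule that)
  interpret S: nonneg_form H "\<lambda>u v. energy_L u v + M * l2 u v" by (rule pos)
  let ?d = "\<lambda>s x. f s x - u x"
  have l2_0: "((\<lambda>s. l2 (?d s) (?d s)) \<longlongrightarrow> 0) F"
  proof (rule tendsto_sandwich[OF _ _ tendsto_const])
    show "\<forall>\<^sub>F s in F. 0 \<le> l2 (?d s) (?d s)"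
      using ev by eventually_elim (intro l2.nonneg l2.diff_closed u)
    show "\<forall>\<^sub>F s in F. l2 (?d s) (?d s) \<le> C * energy (?d s) (?d s)"
      using ev by eventually_elim (intro C l2.diff_closed u)
    show "((\<lambda>s. C * energy (?d s) (?d s)) \<longlongrightarrow> 0) F"
      using tendsto_mult_right[OF lim, of C] by (simp add: tendsto_mult_right_zero lim)
  qed
  show "w \<in> H \<Longrightarrow> ((\<lambda>s. l2 (f s) w) \<longlongrightarrow> l2 u w) F"
    by (rule l2.tendsto_pairing[OF ev u _ l2_0])
  have "((\<lambda>s. energy_L (?d s) (?d s) + M * l2 (?d s) (?d s)) \<longlongrightarrow> 0) F"
  proof (rule tendsto_sandwich[OF _ _ tendsto_const])
    show "\<forall>\<^sub>F s in F. 0 \<le> energy_L (?d s) (?d s) + M * l2 (?d s) (?d s)"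
      using ev by eventually_elim (intro S.nonneg l2.diff_closed u)
    show "\<forall>\<^sub>F s in F. energy_L (?d s) (?d s) + M * l2 (?d s) (?d s)
        \<le> energy (?d s) (?d s) + 2 * M * l2 (?d s) (?d s)"
      using ev
    proof eventually_elim
      case (elim s)
      have "?d s \<in> H" using elim u by (rule l2.diff_closed)
      from M(2)[OF this] show ?case unfolding energy_L_decompose by linarith
    qed
    have "((\<lambda>s. energy (?d s) (?d s) + 2 * M * l2 (?d s) (?d s)) \<longlongrightarrow> 0 + 2 * M * 0) F"
      by (intro tendsto_intros lim l2_0)
    then show "((\<lambda>s. energy (?d s) (?d s) + 2 * M * l2 (?d s) (?d s)) \<longlongrightarrow> 0) F" by simp
  qed
  then have 1: "((\<lambda>s. energy_L (f s) (f s) + M * l2 (f s) (f s))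
      \<longlongrightarrow> energy_L u u + M * l2 u u) F"
    by (rule S.tendsto_square[OF ev u])
  have "((\<lambda>s. energy_L (f s) (f s) + M * l2 (f s) (f s) - M * l2 (f s) (f s))
      \<longlongrightarrow> energy_L u u + M * l2 u u - M * l2 u u) F"
    by (intro tendsto_diff 1 tendsto_mult_left l2.tendsto_square[OF ev u l2_0])
  then show "((\<lambda>s. energy_L (f s) (f s)) \<longlongrightarrow> energy_L u u) F" by simp
qed

text \<open>
  A minimizing sequence has bounded energy, hence a subsequence converging in mean square.  In the
  limit the constraints and the lower order part persist, and the energy can only drop.  With
  \<open>\<phi> = 0\<close> the constraint is void.
\<close>

lemma constrained_minimizer:
  assumes "\<phi> \<in> H" "w \<in> H" "l2 w \<phi> = 0" "l2 w w > 0"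
  obtains u where "u \<in> H" "l2 u \<phi> = 0" "l2 u u = 1"
    "\<And>v. v \<in> H \<Longrightarrow> l2 v \<phi> = 0 \<Longrightarrow> energy_L u u * l2 v v \<le> energy_L v v"
proof -
  obtain M where M: "M > 0" "\<And>u. u \<in> H \<Longrightarrow> \<bar>low_form u u\<bar> \<le> M * l2 u u"
    and pos: "nonneg_form H (\<lambda>u v. low_form u v + M * l2 u v)"
    and "nonneg_form H (\<lambda>u v. energy_L u v + M * l2 u v)"
    by (rule shifted_forms) (rule that)
  interpret S: nonneg_form H "\<lambda>u v. low_form u v + M * l2 u v" by (rule pos)
  define S where "S = {u \<in> H. l2 u \<phi> = 0 \<and> l2 u u = 1}"
  define m where "m = (INF u\<in>S. energy_L u u)"
  have normalize: "(\<lambda>x. (1 / sqrt (l2 v v)) * v x) \<in> S"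
    and normalize_energy: "energy_L (\<lambda>x. (1 / sqrt (l2 v v)) * v x) (\<lambda>x. (1 / sqrt (l2 v v)) * v x)
      = energy_L v v / l2 v v"
    if "v \<in> H" "l2 v \<phi> = 0" "l2 v v > 0" for v
  proof -
    have sq: "(1 / sqrt (l2 v v))\<^sup>2 = 1 / l2 v v" using that(3) by (simp add: power_divide)
    show "(\<lambda>x. (1 / sqrt (l2 v v)) * v x) \<in> S"
      unfolding S_def mem_Collect_eq l2.scale[OF that(1)] sq
      using l2.lin[OF that(1,1) assms(1), of "1 / sqrt (l2 v v)" 0] that
        l2.scale_closed[OF that(1), of "1 / sqrt (l2 v v)"] by simp
    show "energy_L (\<lambda>x. (1 / sqrt (l2 v v)) * v x) (\<lambda>x. (1 / sqrt (l2 v v)) * v x)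
      = energy_L v v / l2 v v"
      unfolding energy_L.scale[OF that(1)] sq by simp
  qed
  have S_ne: "S \<noteq> {}" using normalize[OF assms(2-4)] by blast
  have lower: "- M \<le> energy_L u u" if "u \<in> S" for u
    using that M(2)[of u] energy.nonneg[of u] unfolding energy_L_decompose S_def by fastforce
  have bdd: "bdd_below ((\<lambda>u. energy_L u u) ` S)"
    using lower by (intro bdd_belowI[of _ "- M"]) auto
  have m_le: "m \<le> energy_L u u" if "u \<in> S" for u
    unfolding m_def by (rule cINF_lower[OF bdd that])
  have "\<exists>u\<in>S. energy_L u u < m + 1 / real (Suc n)" for n
    using cINF_less_iff[OF S_ne bdd, of "m + 1 / real (Suc n)"] by (simp add: m_def)
  then obtain f where fS: "\<And>n. f n \<in> S"
    and fm: "\<And>n. energy_L (f n) (f n) < m + 1 / real (Suc n)" by metis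
  have fH: "f n \<in> H" and f1: "l2 (f n) (f n) = 1" and f0: "l2 (f n) \<phi> = 0" for n
    using fS[of n] by (auto simp: S_def)
  have f_lim: "(\<lambda>n. energy_L (f n) (f n)) \<longlonglongrightarrow> m"
  proof (rule tendsto_sandwich[OF _ _ tendsto_const])
    have "(\<lambda>n. m + 1 / real (Suc n)) \<longlonglongrightarrow> m + 0"
      by (intro tendsto_add tendsto_const LIMSEQ_Suc[OF lim_1_over_n])
    then show "(\<lambda>n. m + 1 / real (Suc n)) \<longlonglongrightarrow> m" by simp
  qed (use m_le[OF fS] fm in \<open>auto intro!: always_eventually less_imp_le\<close>)
  have bound: "energy (f n) (f n) \<le> max 1 (m + 1 + M)" "l2 (f n) (f n) \<le> max 1 (m + 1 + M)" for n
  proof -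
    have "1 / real (Suc n) \<le> 1" by simp
    moreover have "\<bar>low_form (f n) (f n)\<bar> \<le> M" using M(2)[OF fH[of n]] f1[of n] by simp
    ultimately have "energy (f n) (f n) \<le> m + 1 + M"
      using fm[of n] unfolding energy_L_decompose by linarith
    then show "energy (f n) (f n) \<le> max 1 (m + 1 + M)" by simp
    show "l2 (f n) (f n) \<le> max 1 (m + 1 + M)" using f1[of n] by simp
  qed
  obtain r u where r: "strict_mono r" and u: "u \<in> H"
    and AE_lim: "AE x in lborel. (\<lambda>n. f (r n) x) \<longlonglongrightarrow> u x"
    and l2_lim: "(\<lambda>n. l2 (\<lambda>x. f (r n) x - u x) (\<lambda>x. f (r n) x - u x)) \<longlonglongrightarrow> 0"
    by (rule compact_embedding[of f, OF fH bound]) (rule that)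
  let ?d = "\<lambda>n x. f (r n) x - u x"
  have dH: "?d n \<in> H" for n by (intro l2.diff_closed fH u)
  have ev: "\<forall>\<^sub>F n in sequentially. f (r n) \<in> H" using fH by simp
  have u1: "l2 u u = 1"
    using l2.tendsto_square[OF ev u l2_lim] by (simp add: f1 LIMSEQ_const_iff)
  have u0: "l2 u \<phi> = 0"
    using l2.tendsto_pairing[OF ev u assms(1) l2_lim] by (simp add: f0 LIMSEQ_const_iff)
  have "(\<lambda>n. low_form (?d n) (?d n) + M * l2 (?d n) (?d n)) \<longlonglongrightarrow> 0"
  proof (rule tendsto_sandwich[OF _ _ tendsto_const])
    show "\<forall>\<^sub>F n in sequentially. 0 \<le> low_form (?d n) (?d n) + M * l2 (?d n) (?d n)"
      by (intro always_eventually allI S.nonneg dH)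
    show "\<forall>\<^sub>F n in sequentially. low_form (?d n) (?d n) + M * l2 (?d n) (?d n)
        \<le> 2 * M * l2 (?d n) (?d n)"
    proof (intro always_eventually allI)
      fix n
      show "low_form (?d n) (?d n) + M * l2 (?d n) (?d n) \<le> 2 * M * l2 (?d n) (?d n)"
        using M(2)[OF dH[of n]] by linarith
    qed
    show "(\<lambda>n. 2 * M * l2 (?d n) (?d n)) \<longlonglongrightarrow> 0"
      using tendsto_mult_left[OF l2_lim, of "2 * M"] by simp
  qed
  then have "(\<lambda>n. low_form (f (r n)) (f (r n)) + M * l2 (f (r n)) (f (r n)))
      \<longlonglongrightarrow> low_form u u + M * l2 u u"
    by (rule S.tendsto_square[OF ev u])
  then have low_lim: "(\<lambda>n. low_form (f (r n)) (f (r n)) + M) \<longlonglongrightarrow> low_form u u + M"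
    unfolding f1 u1 mult_1_right .
  have "(\<lambda>n. energy_L (f (r n)) (f (r n)) - (low_form (f (r n)) (f (r n)) + M) + M)
      \<longlonglongrightarrow> m - (low_form u u + M) + M"
    by (intro tendsto_intros low_lim LIMSEQ_subseq_LIMSEQ[OF f_lim r, unfolded comp_def])
  then have e_lim: "(\<lambda>n. energy (f (r n)) (f (r n))) \<longlonglongrightarrow> m - low_form u u"
    by (simp add: energy_L_decompose)
  have "energy u u \<le> m - low_form u u + e" if "e > 0" for e
  proof (rule energy_Fatou(2)[OF fH H_measurable[OF u] AE_lim])
    have "\<forall>\<^sub>F n in sequentially. energy (f (r n)) (f (r n)) < m - low_form u u + e"
      using that by (intro order_tendstoD(2)[OF e_lim]) simp
    then show "\<forall>\<^sub>F n in sequentially. energy (f (r n)) (f (r n)) \<le> m - low_form u u + e"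
      by (rule eventually_mono) simp
  qed
  then have "energy u u \<le> m - low_form u u" by (rule field_le_epsilon)
  then have u_le: "energy_L u u \<le> m" unfolding energy_L_decompose by linarith
  show thesis
  proof (rule that[OF u u0 u1])
    fix v assume v: "v \<in> H" "l2 v \<phi> = 0"
    show "energy_L u u * l2 v v \<le> energy_L v v"
    proof (cases "l2 v v = 0")
      case True
      then show ?thesis
        using M(2)[OF v(1)] energy.nonneg[OF v(1)] unfolding energy_L_decompose by simp
    next
      case False
      then have "l2 v v > 0" using l2.nonneg[OF v(1)] by simp
      moreover from this have "m \<le> energy_L v v / l2 v v"
        using m_le[OF normalize[OF v]] normalize_energy[OF v] by simp
      ultimately show ?thesis using u_le by (simp add: pos_le_divide_eq)
         (meson mult_right_mono less_imp_le order_trans)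
    qed
  qed
qed

text \<open>The Euler-Lagrange equation on the constraint hyperplane.\<close>

lemma minimizer_weak_equation:
  assumes "u \<in> H" "l2 u \<phi> = 0" "l2 u u = 1" "\<phi> \<in> H" "v \<in> H" "l2 v \<phi> = 0"
    and min: "\<And>v. v \<in> H \<Longrightarrow> l2 v \<phi> = 0 \<Longrightarrow> energy_L u u * l2 v v \<le> energy_L v v"
  shows "energy_L u v = energy_L u u * l2 u v"
proof -
  let ?Q = "\<lambda>v w. energy_L v w - energy_L u u * l2 v w"
  interpret Q: symmetric_form H ?Q
    using symmetric_form_combine[OF energy_L.symmetric_form_axioms l2.symmetric_form_axioms,
        of 1 "- energy_L u u"] by simp
  have "?Q u v = 0"
  proof (rule Q.isotropic_minimum_orthogonal)
    fix a
    have "(\<lambda>x. u x + a * v x) \<in> H" using H_lin_closed[OF assms(1,5), of 1 a] by simp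
    moreover have "l2 (\<lambda>x. u x + a * v x) \<phi> = 0"
      using l2.lin[OF assms(1,5,4), of 1 a] assms by simp
    ultimately show "0 \<le> ?Q (\<lambda>x. u x + a * v x) (\<lambda>x. u x + a * v x)"
      using min[of "\<lambda>x. u x + a * v x"] by linarith
  qed (use assms in auto)
  then show ?thesis by linarith
qed

lemma eigenfunction_iff:
  "eigenfunction \<Omega> lam u \<longleftrightarrow> u \<in> H \<and> l2 u u \<noteq> 0 \<and> (\<forall>v\<in>H. energy_L u v = lam * l2 u v)"
  unfolding eigenfunction_def using null_iff_l2 set_integral_l2 by auto

text \<open>
  The unconstrained minimum of \<open>E\<^sub>L\<close> on the sphere is an eigenvalue and bounds every Rayleigh
  quotient from below, so the least eigenvalue exists.
\<close>

lemma nth_eigenvalue_1_le: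
  assumes "\<Omega> \<noteq> {}" "eigenvalue \<Omega> \<mu>"
  shows "nth_eigenvalue \<Omega> 1 \<le> \<mu>"
proof -
  let ?z = "\<lambda>x :: real ^ 'n. 0 :: real"
  have z: "?z \<in> H" by (simp add: H_space_def case_prod_beta')
  have lz: "l2 v ?z = 0" for v by (simp add: l2_def)
  obtain w where w: "w \<in> H" "l2 w ?z = 0" "l2 w w > 0"
    using exists_orthogonal[OF assms(1) z] by blast
  obtain u where u: "u \<in> H" "l2 u u = 1"
    and min: "\<And>v. v \<in> H \<Longrightarrow> energy_L u u * l2 v v \<le> energy_L v v"
    using constrained_minimizer[OF z w] lz by metis
  have weak: "energy_L u v = energy_L u u * l2 u v" if "v \<in> H" for v
    by (rule minimizer_weak_equation[OF u(1) lz u(2) z that lz]) (rule min)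
  have eig: "eigenfunction \<Omega> (energy_L u u) u"
    unfolding eigenfunction_iff by (intro conjI ballI weak) (simp_all add: u)
  have least: "energy_L u u \<le> \<nu>" if "eigenvalue \<Omega> \<nu>" for \<nu>
  proof -
    obtain v where v: "v \<in> H" "l2 v v \<noteq> 0" "energy_L v v = \<nu> * l2 v v"
      using \<open>eigenvalue \<Omega> \<nu>\<close> by (auto simp: eigenvalue_def eigenfunction_iff)
    then have "l2 v v > 0" using l2.nonneg[OF v(1)] by simp
    then show ?thesis using min[OF v(1)] v(3) by simp
  qed
  have one: "(\<forall>i<1. P i) \<longleftrightarrow> P 0" for P :: "nat \<Rightarrow> bool" by auto
  have sum1: "(\<Sum>i<1. g i) = g 0" for g :: "nat \<Rightarrow> real" by simp
  have "nth_eigenvalue \<Omega> 1 = energy_L u u"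
    unfolding nth_eigenvalue_def one sum1
  proof (rule Least_equality)
    have "c 0 = 0" if "AE x in lborel. c 0 * u x = 0" for c :: "nat \<Rightarrow> real"
    proof -
      have "l2 (\<lambda>x. c 0 * u x) (\<lambda>x. c 0 * u x) = 0"
        using that null_iff_l2[OF l2.scale_closed[OF u(1)]] by blast
      then show ?thesis using l2.scale[OF u(1)] u(2) by simp
    qed
    then show "eigenvalue \<Omega> (energy_L u u) \<and>
      (\<exists>e. (\<exists>\<mu>\<le>energy_L u u. eigenfunction \<Omega> \<mu> (e 0)) \<and>
         (\<forall>c. (AE x in lborel. c 0 * e 0 x = 0) \<longrightarrow> c 0 = 0))"
      using eig unfolding eigenvalue_def by (intro conjI exI[of _ "\<lambda>_. u"]) auto
  qed (use least in blast)
  then show ?thesis using least[OF assms(2)] by simp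
qed

text \<open>
  Two eigenfunctions for eigenvalues at most \<open>\<nu>\<close> span a space on which \<open>E\<^sub>L \<le> \<nu> \<parallel>\<cdot>\<parallel>\<^sup>2\<close>: either the
  eigenvalues agree or the eigenfunctions are orthogonal.
\<close>

lemma energy_L_le_on_eigenspan:
  assumes "eigenfunction \<Omega> \<mu> u" "eigenfunction \<Omega> \<mu>' v" "\<mu> \<le> \<nu>" "\<mu>' \<le> \<nu>"
  shows "energy_L (\<lambda>x. a * u x + b * v x) (\<lambda>x. a * u x + b * v x)
     \<le> \<nu> * l2 (\<lambda>x. a * u x + b * v x) (\<lambda>x. a * u x + b * v x)"
proof -
  have H: "u \<in> H" "v \<in> H" using assms by (auto simp: eigenfunction_iff)
  have E: "energy_L u u = \<mu> * l2 u u" "energy_L u v = \<mu> * l2 u v" "energy_L v v = \<mu>' * l2 v v"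
    "energy_L v u = \<mu>' * l2 v u"
    using assms H by (auto simp: eigenfunction_iff)
  have "\<mu> * l2 u v = \<mu>' * l2 u v"
    using E(2,4) energy_L.sym[OF H] l2.sym[OF H] by metis
  then consider "\<mu> = \<mu>'" | "l2 u v = 0" by auto
  then show ?thesis
  proof cases
    case 1
    have "energy_L (\<lambda>x. a * u x + b * v x) (\<lambda>x. a * u x + b * v x)
        = \<mu> * l2 (\<lambda>x. a * u x + b * v x) (\<lambda>x. a * u x + b * v x)"
      unfolding energy_L.expand[OF H] l2.expand[OF H] E 1 by (simp add: algebra_simps)
    also have "\<dots> \<le> \<nu> * l2 (\<lambda>x. a * u x + b * v x) (\<lambda>x. a * u x + b * v x)"
      by (intro mult_right_mono assms l2.nonneg H_lin_closed H)
    finally show ?thesis .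
  next
    case 2
    have "a\<^sup>2 * (\<mu> * l2 u u) + b\<^sup>2 * (\<mu>' * l2 v v) \<le> a\<^sup>2 * (\<nu> * l2 u u) + b\<^sup>2 * (\<nu> * l2 v v)"
      by (intro add_mono mult_left_mono mult_right_mono assms l2.nonneg H) auto
    then show ?thesis
      unfolding energy_L.expand[OF H] l2.expand[OF H] E 2 by (simp add: algebra_simps)
  qed
qed

text \<open>
  A minimizer \<open>u\<close> orthogonal to \<open>\<phi>\<close> solves the eigenvalue equation against test functions orthogonal
  to \<open>\<phi>\<close>, and against \<open>\<phi>\<close> itself because \<open>\<phi>\<close> is an eigenfunction.  No smaller number is a second
  eigenvalue: a plane spanned by two eigenfunctions contains a direction orthogonal to \<open>\<phi>\<close>, where
  \<open>E\<^sub>L\<close> is at least the minimum.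
\<close>

lemma second_eigenvalue_variational:
  assumes ne: "\<Omega> \<noteq> {}" and \<phi>: "eigenfunction \<Omega> (nth_eigenvalue \<Omega> 1) \<phi>" and norm: "l2 \<phi> \<phi> = 1"
  obtains u where "eigenfunction \<Omega> (nth_eigenvalue \<Omega> 2) u" "l2 u \<phi> = 0" "l2 u u = 1"
    "nth_eigenvalue \<Omega> 1 \<le> nth_eigenvalue \<Omega> 2"
    "\<And>v. v \<in> H \<Longrightarrow> l2 v \<phi> = 0 \<Longrightarrow> nth_eigenvalue \<Omega> 2 * l2 v v \<le> energy_L v v"
proof -
  let ?l1 = "nth_eigenvalue \<Omega> 1"
  have \<phi>H: "\<phi> \<in> H" and \<phi>E: "\<And>v. v \<in> H \<Longrightarrow> energy_L \<phi> v = ?l1 * l2 \<phi> v"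
    using \<phi> unfolding eigenfunction_iff by blast+
  obtain w where w: "w \<in> H" "l2 w \<phi> = 0" "l2 w w > 0"
    using exists_orthogonal[OF ne \<phi>H] by blast
  obtain u where u: "u \<in> H" "l2 u \<phi> = 0" "l2 u u = 1"
    and min: "\<And>v. v \<in> H \<Longrightarrow> l2 v \<phi> = 0 \<Longrightarrow> energy_L u u * l2 v v \<le> energy_L v v"
    using constrained_minimizer[OF \<phi>H w] by metis
  let ?l2 = "energy_L u u"
  have u\<phi>: "energy_L u \<phi> = 0"
    using \<phi>E[OF u(1)] energy_L.sym[OF u(1) \<phi>H] l2.sym[OF u(1) \<phi>H] u(2) by simp
  have weak: "energy_L u v = ?l2 * l2 u v" if v: "v \<in> H" for v
  proof -
    let ?c = "l2 v \<phi>"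
    let ?p = "\<lambda>x. 1 * v x + (- ?c) * \<phi> x"
    have p: "?p \<in> H" by (rule H_lin_closed[OF v \<phi>H])
    have "l2 ?p \<phi> = 0" using l2.lin[OF v \<phi>H \<phi>H, of 1 "- ?c"] norm by simp
    then have "energy_L u ?p = ?l2 * l2 u ?p"
      by (rule minimizer_weak_equation[OF u \<phi>H p _ min])
    then show ?thesis
      unfolding energy_L.lin_right[OF v \<phi>H u(1)] l2.lin_right[OF v \<phi>H u(1)] u\<phi> u(2) by simp
  qed
  have u_eig: "eigenfunction \<Omega> ?l2 u"
    unfolding eigenfunction_iff by (intro conjI ballI weak) (simp_all add: u)
  then have "eigenvalue \<Omega> ?l2" by (auto simp: eigenvalue_def)
  then have l12: "?l1 \<le> ?l2" by (rule nth_eigenvalue_1_le[OF ne])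
  have two: "(\<forall>i<2. P i) \<longleftrightarrow> P 0 \<and> P (Suc 0)" for P :: "nat \<Rightarrow> bool"
    by (auto simp: less_2_cases_iff)
  have sum2: "(\<Sum>i<2. g i) = g 0 + g (Suc 0)" for g :: "nat \<Rightarrow> real"
    by (simp add: numeral_2_eq_2)
  have "nth_eigenvalue \<Omega> 2 = ?l2"
    unfolding nth_eigenvalue_def two sum2
  proof (rule Least_equality)
    let ?e = "\<lambda>i::nat. if i = 0 then \<phi> else u"
    have "c 0 = 0 \<and> c (Suc 0) = 0" if "AE x in lborel. c 0 * \<phi> x + c (Suc 0) * u x = 0"
      for c :: "nat \<Rightarrow> real"
    proof -
      have "l2 (\<lambda>x. c 0 * \<phi> x + c (Suc 0) * u x) (\<lambda>x. c 0 * \<phi> x + c (Suc 0) * u x) = 0"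
        using that null_iff_l2[OF H_lin_closed[OF \<phi>H u(1)]] by blast
      then have "(c 0)\<^sup>2 + (c (Suc 0))\<^sup>2 = 0"
        using l2.expand[OF \<phi>H u(1)] norm u(2,3) l2.sym[OF u(1) \<phi>H] by simp
      then show ?thesis by (simp add: sum_power2_eq_zero_iff)
    qed
    then show "eigenvalue \<Omega> ?l2 \<and> (\<exists>e. ((\<exists>\<mu>\<le>?l2. eigenfunction \<Omega> \<mu> (e 0)) \<and>
        (\<exists>\<mu>\<le>?l2. eigenfunction \<Omega> \<mu> (e (Suc 0)))) \<and>
        (\<forall>c. (AE x in lborel. c 0 * e 0 x + c (Suc 0) * e (Suc 0) x = 0) \<longrightarrow>
          c 0 = 0 \<and> c (Suc 0) = 0))"
      using \<open>eigenvalue \<Omega> ?l2\<close> \<phi> l12 u_eig by (intro conjI exI[of _ ?e]) auto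
  next
    fix \<nu>
    assume "eigenvalue \<Omega> \<nu> \<and> (\<exists>e. ((\<exists>\<mu>\<le>\<nu>. eigenfunction \<Omega> \<mu> (e 0)) \<and>
        (\<exists>\<mu>\<le>\<nu>. eigenfunction \<Omega> \<mu> (e (Suc 0)))) \<and>
        (\<forall>c. (AE x in lborel. c 0 * e 0 x + c (Suc 0) * e (Suc 0) x = 0) \<longrightarrow>
          c 0 = 0 \<and> c (Suc 0) = 0))"
    then obtain e \<mu> \<mu>' where e: "\<mu> \<le> \<nu>" "eigenfunction \<Omega> \<mu> (e 0)" "\<mu>' \<le> \<nu>"
        "eigenfunction \<Omega> \<mu>' (e (Suc 0))"
      and indep: "\<And>c :: nat \<Rightarrow> real. (AE x in lborel. c 0 * e 0 x + c (Suc 0) * e (Suc 0) x = 0)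
          \<Longrightarrow> c 0 = 0 \<and> c (Suc 0) = 0"
      by blast
    have eH: "e 0 \<in> H" "e (Suc 0) \<in> H" using e by (auto simp: eigenfunction_iff)
    obtain a b where ab: "a \<noteq> 0 \<or> b \<noteq> 0" "a * l2 (e 0) \<phi> + b * l2 (e (Suc 0)) \<phi> = 0"
      by (rule exists_annihilating_pair)
    let ?w = "\<lambda>x. a * e 0 x + b * e (Suc 0) x"
    have wH: "?w \<in> H" by (rule H_lin_closed[OF eH])
    have "l2 ?w \<phi> = 0" using l2.lin[OF eH \<phi>H, of a b] ab(2) by simp
    have "a = 0 \<and> b = 0" if "AE x in lborel. ?w x = 0"
      using indep[of "case_nat a (\<lambda>_. b)"] that by (simp only: nat.case)
    then have "\<not> (AE x in lborel. ?w x = 0)" using ab(1) by blast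
    then have "l2 ?w ?w > 0" using null_iff_l2[OF wH] l2.nonneg[OF wH] by simp
    moreover have "?l2 * l2 ?w ?w \<le> \<nu> * l2 ?w ?w"
      using min[OF wH \<open>l2 ?w \<phi> = 0\<close>] energy_L_le_on_eigenspan[OF e(2,4,1,3), of a b] by linarith
    ultimately show "?l2 \<le> \<nu>" by simp
  qed
  then show thesis using that[of u] u_eig u l12 min by simp
qed

section \<open>Paths on the sphere\<close>

lemma P_sphere_iff: "u \<in> P_sphere \<Omega> \<longleftrightarrow> u \<in> H \<and> l2 u u = 1"
  using set_integral_l2[of u u] by (auto simp: P_sphere_def power2_eq_square)

lemma path_continuous:
  assumes "\<gamma> \<in> P_paths \<Omega> \<phi>"
  shows "continuous_on {-1..1} (\<lambda>t. energy_L (\<gamma> t) (\<gamma> t))"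
    and "w \<in> H \<Longrightarrow> continuous_on {-1..1} (\<lambda>t. l2 (\<gamma> t) w)"
proof -
  have H: "\<gamma> t \<in> H" if "t \<in> {-1..1}" for t
    using assms that P_sphere_iff by (auto simp: P_paths_def)
  have ev: "\<forall>\<^sub>F s in at t within {-1..1}. \<gamma> s \<in> H" for t
    unfolding eventually_at_filter by (intro always_eventually) (use H in blast)
  have lim: "((\<lambda>s. energy (\<lambda>x. \<gamma> s x - \<gamma> t x) (\<lambda>x. \<gamma> s x - \<gamma> t x)) \<longlongrightarrow> 0) (at t within {-1..1})"
    if t: "t \<in> {-1..1}" for t
  proof -
    have "((\<lambda>s. H_norm (\<lambda>x. \<gamma> s x - \<gamma> t x)) \<longlongrightarrow> 0) (at t within {-1..1})"
      using assms t by (auto simp: P_paths_def)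
    then have "((\<lambda>s. (H_norm (\<lambda>x. \<gamma> s x - \<gamma> t x))\<^sup>2) \<longlongrightarrow> 0\<^sup>2) (at t within {-1..1})"
      by (rule tendsto_power)
    moreover have "\<forall>\<^sub>F s in at t within {-1..1}. (H_norm (\<lambda>x. \<gamma> s x - \<gamma> t x))\<^sup>2
        = energy (\<lambda>x. \<gamma> s x - \<gamma> t x) (\<lambda>x. \<gamma> s x - \<gamma> t x)"
      using ev[of t]
      by eventually_elim (use H[OF t] in \<open>simp add: H_norm_def energy.nonneg l2.diff_closed\<close>)
    ultimately show ?thesis by (simp add: tendsto_cong)
  qed
  show "continuous_on {-1..1} (\<lambda>t. energy_L (\<gamma> t) (\<gamma> t))"
    unfolding continuous_on_def using energy_L_tendsto_of_energy(1)[OF ev H lim] by blast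
  show "w \<in> H \<Longrightarrow> continuous_on {-1..1} (\<lambda>t. l2 (\<gamma> t) w)"
    unfolding continuous_on_def using energy_L_tendsto_of_energy(2)[OF ev H lim] by blast
qed

text \<open>Along the path, the pairing with \<open>\<phi>\<close> goes continuously from \<open>-1\<close> to \<open>1\<close>.\<close>

lemma path_crosses_hyperplane:
  assumes \<gamma>: "\<gamma> \<in> P_paths \<Omega> \<phi>" and \<phi>: "\<phi> \<in> H" "l2 \<phi> \<phi> = 1"
  obtains t where "t \<in> {-1..1}" "l2 (\<gamma> t) \<phi> = 0"
proof -
  have [measurable]: "\<phi> \<in> borel_measurable borel" by (rule H_measurable[OF \<phi>(1)])
  have m: "\<gamma> (-1) \<in> borel_measurable borel" "\<gamma> 1 \<in> borel_measurable borel"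
    using \<gamma> by (auto simp: P_paths_def P_sphere_def H_space_def)
  note [measurable] = m
  have "l2 (\<gamma> (-1)) \<phi> = (\<integral>x. - (\<phi> x * \<phi> x) \<partial>lborel)"
    unfolding l2_def using \<gamma>
    by (intro integral_cong_AE) (auto simp: P_paths_def elim: eventually_mono)
  then have start: "l2 (\<gamma> (-1)) \<phi> = -1" using \<phi>(2) by (simp add: l2_def)
  have "l2 (\<gamma> 1) \<phi> = (\<integral>x. \<phi> x * \<phi> x \<partial>lborel)"
    unfolding l2_def using \<gamma>
    by (intro integral_cong_AE) (auto simp: P_paths_def elim: eventually_mono)
  then have stop: "l2 (\<gamma> 1) \<phi> = 1" using \<phi>(2) by (simp add: l2_def)
  have "\<exists>t\<ge>-1. t \<le> 1 \<and> l2 (\<gamma> t) \<phi> = 0"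
    by (rule IVT') (use start stop path_continuous(2)[OF \<gamma> \<phi>(1)] in auto)
  then show thesis using that by auto
qed

text \<open>
  The half circle from \<open>-\<phi>\<close> through \<open>u\<close> to \<open>\<phi>\<close> in the plane of \<open>\<phi>\<close> and \<open>u\<close>.
\<close>

lemma half_circle_path:
  assumes H: "\<phi> \<in> H" "u \<in> H" and "l2 \<phi> \<phi> = 1" "l2 u u = 1" "l2 \<phi> u = 0"
  shows "(\<lambda>t x. sin (pi / 2 * t) * \<phi> x + cos (pi / 2 * t) * u x) \<in> P_paths \<Omega> \<phi>"
proof -
  let ?g = "\<lambda>t x. sin (pi / 2 * t) * \<phi> x + cos (pi / 2 * t) * u x"
  have "?g t \<in> P_sphere \<Omega>" for t
    unfolding P_sphere_iff l2.expand[OF H] using assms H_lin_closed[OF H] by simp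
  moreover have "((\<lambda>s. H_norm (\<lambda>x. ?g s x - ?g t x)) \<longlongrightarrow> 0) (at t within {-1..1})" for t
  proof -
    have eq: "(\<lambda>x. ?g s x - ?g t x) = (\<lambda>x. (sin (pi / 2 * s) - sin (pi / 2 * t)) * \<phi> x
        + (cos (pi / 2 * s) - cos (pi / 2 * t)) * u x)" for s
      by (simp add: algebra_simps fun_eq_iff)
    have "((\<lambda>s. sqrt ((sin (pi / 2 * s) - sin (pi / 2 * t))\<^sup>2 * energy \<phi> \<phi>
         + 2 * (sin (pi / 2 * s) - sin (pi / 2 * t)) * (cos (pi / 2 * s) - cos (pi / 2 * t)) * energy \<phi> u
         + (cos (pi / 2 * s) - cos (pi / 2 * t))\<^sup>2 * energy u u))
      \<longlongrightarrow> sqrt ((sin (pi / 2 * t) - sin (pi / 2 * t))\<^sup>2 * energy \<phi> \<phi>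
         + 2 * (sin (pi / 2 * t) - sin (pi / 2 * t)) * (cos (pi / 2 * t) - cos (pi / 2 * t)) * energy \<phi> u
         + (cos (pi / 2 * t) - cos (pi / 2 * t))\<^sup>2 * energy u u)) (at t within {-1..1})"
      by (intro tendsto_intros)
    then show ?thesis unfolding H_norm_def eq energy.expand[OF H] by simp
  qed
  ultimately show ?thesis by (simp add: P_paths_def)
qed

end

section \<open>The minimax characterization\<close>

theorem corollary4p6:
  fixes \<Omega> :: "(real ^ 'n) set" and \<phi>\<^sub>1 :: "real ^ 'n \<Rightarrow> real"
  assumes "open \<Omega>" and "connected \<Omega>" and "\<Omega> \<noteq> {}" and "bounded \<Omega>" and "C11_boundary \<Omega>"
    and "eigenfunction \<Omega> (nth_eigenvalue \<Omega> 1) \<phi>\<^sub>1"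
    and "AE x in lborel. x \<in> \<Omega> \<longrightarrow> \<phi>\<^sub>1 x > 0"
    and "(LINT x:\<Omega>|lborel. (\<phi>\<^sub>1 x)\<^sup>2) = 1"
  shows "(\<forall>\<gamma>\<in>P_paths \<Omega> \<phi>\<^sub>1. \<exists>u\<in>\<gamma> ` {-1..1}. \<forall>v\<in>\<gamma> ` {-1..1}. energy_L v v \<le> energy_L u u) \<and>
    ereal (nth_eigenvalue \<Omega> 2) =
      (INF \<gamma>\<in>P_paths \<Omega> \<phi>\<^sub>1. SUP u\<in>\<gamma> ` {-1..1}. ereal (energy_L u u))"
proof -
  interpret bounded_domain \<Omega> by unfold_locales fact+
  let ?l1 = "nth_eigenvalue \<Omega> 1" and ?l2 = "nth_eigenvalue \<Omega> 2"
  have \<phi>: "\<phi>\<^sub>1 \<in> H_space \<Omega>" using assms(6) by (simp add: eigenfunction_def)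
  have norm: "l2 \<phi>\<^sub>1 \<phi>\<^sub>1 = 1"
    using assms(8) set_integral_l2[OF \<phi>, of \<phi>\<^sub>1] by (simp add: power2_eq_square)
  obtain u where u_eig: "eigenfunction \<Omega> ?l2 u" and u: "l2 u \<phi>\<^sub>1 = 0" "l2 u u = 1"
    and l12: "?l1 \<le> ?l2"
    and min: "\<And>v. v \<in> H_space \<Omega> \<Longrightarrow> l2 v \<phi>\<^sub>1 = 0 \<Longrightarrow> ?l2 * l2 v v \<le> energy_L v v"
    by (rule second_eigenvalue_variational[OF assms(3,6) norm]) (rule that)
  have uH: "u \<in> H_space \<Omega>" using u_eig by (simp add: eigenfunction_def)
  have attained: "\<exists>u\<in>\<gamma> ` {-1..1}. \<forall>v\<in>\<gamma> ` {-1..1}. energy_L v v \<le> energy_L u u"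
    if "\<gamma> \<in> P_paths \<Omega> \<phi>\<^sub>1" for \<gamma>
  proof -
    have "\<exists>s\<in>{-1..1}. \<forall>t\<in>{-1..1}. energy_L (\<gamma> t) (\<gamma> t) \<le> energy_L (\<gamma> s) (\<gamma> s)"
      by (rule continuous_attains_sup) (use path_continuous(1)[OF that] in auto)
    then show ?thesis by blast
  qed
  have lower: "ereal ?l2 \<le> (SUP u\<in>\<gamma> ` {-1..1}. ereal (energy_L u u))"
    if \<gamma>: "\<gamma> \<in> P_paths \<Omega> \<phi>\<^sub>1" for \<gamma>
  proof -
    obtain t where t: "t \<in> {-1..1}" "l2 (\<gamma> t) \<phi>\<^sub>1 = 0"
      by (rule path_crosses_hyperplane[OF \<gamma> \<phi> norm])
    have "\<gamma> t \<in> P_sphere \<Omega>" using \<gamma> t(1) by (simp add: P_paths_def)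
    then have "?l2 \<le> energy_L (\<gamma> t) (\<gamma> t)"
      using min[OF _ t(2)] by (simp add: P_sphere_iff)
    then show ?thesis
      by (intro SUP_upper2[of "\<gamma> t"]) (use t(1) in auto)
  qed
  let ?g = "\<lambda>t x. sin (pi / 2 * t) * \<phi>\<^sub>1 x + cos (pi / 2 * t) * u x"
  have orth: "l2 \<phi>\<^sub>1 u = 0" using u(1) l2.sym[OF uH \<phi>] by simp
  have g: "?g \<in> P_paths \<Omega> \<phi>\<^sub>1" by (rule half_circle_path[OF \<phi> uH norm u(2) orth])
  have "energy_L (?g t) (?g t) \<le> ?l2" for t
    using energy_L_le_on_eigenspan[OF assms(6) u_eig l12 order_refl,
        of "sin (pi / 2 * t)" "cos (pi / 2 * t)"]
    unfolding l2.expand[OF \<phi> uH] norm u(2) orth by simp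
  then have "(SUP u\<in>?g ` {-1..1}. ereal (energy_L u u)) \<le> ereal ?l2"
    by (intro SUP_least) auto
  then have "(INF \<gamma>\<in>P_paths \<Omega> \<phi>\<^sub>1. SUP u\<in>\<gamma> ` {-1..1}. ereal (energy_L u u)) \<le> ereal ?l2"
    by (rule INF_lower2[OF g])
  moreover have "ereal ?l2 \<le> (INF \<gamma>\<in>P_paths \<Omega> \<phi>\<^sub>1. SUP u\<in>\<gamma> ` {-1..1}. ereal (energy_L u u))"
    by (rule INF_greatest) (rule lower)
  ultimately show ?thesis using attained by (intro conjI ballI antisym) auto
qed

end
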